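(* Let $W=(W(t))_{t\ge 0}$ be a standard Brownian motion in $\mathbb{R}^3$ started at the origin. Then almost surely the trace $W[0,\infty)=\{W(t):t\ge 0\}$ contains no arithmetic progression of length $6$; that is, almost surely there do not exist $a,v\in\mathbb{R}^3$ with $v\ne 0$ such that $a+jv\in W[0,\infty)$ for all $j\in\{0,1,2,3,4,5\}$.
   Context: An arithmetic progression of length $m$ in $\mathbb{R}^3$ is a sequence of points $a,a+v,\dotsc,a+(m-1)v$ with $a,v\in\mathbb{R}^3$ and $v\neq 0$. The points of the progression may be visited by the Brownian motion in any order. *)

theory Defs
  imports "HOL-Probability.Probability"
begin

text \<open>
  The density of the normal distribution \<open>N(0, \<sigma>\<^sup>2 I)\<close> on \<open>\<real>\<^sup>d\<close>, where the parameter
  \<open>\<sigma>\<close> is the standard deviation of each coordinate.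
\<close>
definition isotropic_normal_density :: "real \<Rightarrow> real ^ 'd \<Rightarrow> real" where
  "isotropic_normal_density \<sigma> x = (\<Prod>i\<in>UNIV. normal_density 0 \<sigma> (x $ i))"

text \<open>
  The process is a family of random variables indexed by all reals, of which only the times
  \<open>t \<ge> 0\<close> are constrained. The initial value and the continuity of paths are required almost
  surely only; no filtration is involved.
\<close>
locale standard_brownian_motion = prob_space M
  for M :: "'a measure" and W :: "real \<Rightarrow> 'a \<Rightarrow> real ^ 'd" +
  assumes measurable_W: "0 \<le> t \<Longrightarrow> W t \<in> borel_measurable M"
    and start_at_origin: "AE \<omega> in M. W 0 \<omega> = 0"
    and independent_increments:
      "0 \<le> s 0 \<Longrightarrow> (\<And>i. i < n \<Longrightarrow> s i \<le> s (Suc i)) \<Longrightarrow>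
        indep_vars (\<lambda>_. borel) (\<lambda>i \<omega>. W (s (Suc i)) \<omega> - W (s i) \<omega>) {..<n}"
    and normal_increments:
      "0 \<le> r \<Longrightarrow> r < t \<Longrightarrow>
        distributed M lborel (\<lambda>\<omega>. W t \<omega> - W r \<omega>)
          (\<lambda>x. ennreal (isotropic_normal_density (sqrt (t - r)) x))"
    and continuous_paths: "AE \<omega> in M. continuous_on {0..} (\<lambda>t. W t \<omega>)"

definition trace_of :: "(real \<Rightarrow> 'a \<Rightarrow> 'b) \<Rightarrow> 'a \<Rightarrow> 'b set" where
  "trace_of W \<omega> = {W t \<omega> |t. 0 \<le> t}"

definition contains_arith_prog :: "nat \<Rightarrow> 'b::real_vector set \<Rightarrow> bool" where
  "contains_arith_prog m S \<longleftrightarrow> (\<exists>a v. v \<noteq> 0 \<and> (\<forall>j<m. a + real j *\<^sub>R v \<in> S))"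

end

theory Submission
  imports Defs
begin

text \<open>
  The problem is critical: six path segments, each of dimension two, against the
  twelve equations \<open>x\<^sub>i = \<alpha>\<^sub>i x\<^sub>0 + \<beta>\<^sub>i x\<^sub>1\<close> (\<open>2 \<le> i \<le> 5\<close>) that put six points into a progression,
  where \<open>x\<^sub>0\<close>, \<open>x\<^sub>1\<close> are the two points visited first. The argument adapts Levy's proof that the
  planar Brownian path has area zero. Let \<open>K\<close> be the image in \<open>\<real>\<^sup>1\<^sup>2\<close> of six independent segments
  under \<open>x \<mapsto> (x\<^sub>i - \<alpha>\<^sub>i x\<^sub>0 - \<beta>\<^sub>i x\<^sub>1)\<^sub>i\<close> and \<open>m\<close> its expected volume, which is finite by a chaining bound.
  Tripling the duration of the segments multiplies \<open>m\<close> by \<open>3\<^sup>6\<close> by Brownian scaling, and the longer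
  segments split into \<open>3\<^sup>6\<close> sextuples of short ones, so any two of these \<open>3\<^sup>6\<close> images overlap
  in a null set. But the first and the last of them are independent and displaced against each other
  by an independent vector with a positive density, so the expected volume of their overlap
  vanishes only if \<open>m = 0\<close>. Finally, for time-separated segments of one path the increments over the gaps
  displace the image by a vector with a density, so a fixed point is almost surely not hit.
\<close>

section \<open>Dyadic skeleton of the path\<close>

text \<open>Countable time set for the path space: laws of paths are then determined by finite
  cylinders, and closures over these times remain measurable. The endpoint 1 belongs to it because
  the value at 1 is the increment over a whole block.\<close>

definition dyadics :: "real set" where
  "dyadics = {real i / 2 ^ n | i n. i \<le> 2 ^ n}"

lemma dyadicsI: "i \<le> 2 ^ n \<Longrightarrow> real i / 2 ^ n \<in> dyadics"
  by (auto simp: dyadics_def)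

lemma dyadics_0: "0 \<in> dyadics" and dyadics_1: "1 \<in> dyadics"
  using dyadicsI[of 0 0] dyadicsI[of 1 0] by auto

lemma dyadics_bounds:
  assumes "d \<in> dyadics"
  shows "0 \<le> d" "d \<le> 1"
proof -
  obtain i n where "d = real i / 2 ^ n" "i \<le> 2 ^ n"
    using assms by (auto simp: dyadics_def)
  moreover from this have "real i \<le> 2 ^ n"
    by (metis of_nat_le_iff of_nat_numeral of_nat_power)
  ultimately show "0 \<le> d" "d \<le> 1" by auto
qed

lemma countable_dyadics: "countable dyadics"
proof -
  have "dyadics \<subseteq> (\<lambda>(i, n). real i / 2 ^ n) ` UNIV"
    by (auto simp: dyadics_def)
  then show ?thesis
    by (rule countable_subset) auto
qed

text \<open>A dyadic of level \<open>m\<close> lies on every finer grid, so the largest level serves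
  the whole set. This reduces a cylinder event to finitely many grid increments.\<close>

lemma dyadics_finite_subset_grid:
  assumes "finite J" "J \<subseteq> dyadics"
  shows "\<exists>n0. \<forall>n\<ge>n0. \<forall>d\<in>J. \<exists>i\<le>2 ^ n. d = real i / 2 ^ n"
  using assms
proof (induction J)
  case empty
  then show ?case by auto
next
  case (insert x F)
  then obtain n0 where n0: "\<forall>n\<ge>n0. \<forall>d\<in>F. \<exists>i\<le>2 ^ n. d = real i / 2 ^ n" by auto
  from insert obtain j m where jm: "x = real j / 2 ^ m" "j \<le> 2 ^ m"
    by (auto simp: dyadics_def)
  have "\<exists>i\<le>2 ^ n. x = real i / 2 ^ n" if "n \<ge> m" for n
  proof (intro exI[of _ "j * 2 ^ (n - m)"] conjI)
    have "(2::nat) ^ n = 2 ^ m * 2 ^ (n - m)"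
      using that by (simp flip: power_add)
    then show "j * 2 ^ (n - m) \<le> 2 ^ n"
      using jm by simp
    have "(2::real) ^ n = 2 ^ m * 2 ^ (n - m)"
      using that by (simp flip: power_add)
    then show "x = real (j * 2 ^ (n - m)) / 2 ^ n"
      using jm by simp
  qed
  with n0 show ?case
    by (intro exI[of _ "max n0 m"]) auto
qed

section \<open>Scaling of isotropic Gaussian densities\<close>

lemma isotropic_normal_density_measurable [measurable]:
  "isotropic_normal_density \<sigma> \<in> borel_measurable borel"
  unfolding isotropic_normal_density_def by measurable

lemma isotropic_normal_density_pos: "\<sigma> > 0 \<Longrightarrow> isotropic_normal_density \<sigma> x > 0"
  unfolding isotropic_normal_density_def by (intro prod_pos) (auto intro: normal_density_pos)

lemma isotropic_normal_density_scale:
  fixes x :: "real ^ 'd"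
  assumes "a > 0"
  shows "a ^ CARD('d) * isotropic_normal_density (a * \<sigma>) (a *\<^sub>R x) = isotropic_normal_density \<sigma> x"
proof -
  have "a * normal_density 0 (a * \<sigma>) (a * y) = normal_density 0 \<sigma> y" for y
    using assms by (auto simp: normal_density_def field_simps real_sqrt_mult)
  then have "(\<Prod>i\<in>UNIV. a * normal_density 0 (a * \<sigma>) (a * x $ (i::'d))) = (\<Prod>i\<in>UNIV. normal_density 0 \<sigma> (x $ i))"
    by simp
  then show ?thesis
    by (simp add: isotropic_normal_density_def prod.distrib)
qed

text \<open>Change of variables: the Jacobian \<open>a ^ CARD('d)\<close> of the dilation is exactly
  the factor by which the density changes.\<close>

lemma distr_isotropic_normal_scale:
  fixes \<sigma> :: real
  assumes "a > 0" "\<sigma> > 0"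
  shows "distr (density lborel (isotropic_normal_density \<sigma> :: real ^ 'd \<Rightarrow> real)) borel (\<lambda>x. a *\<^sub>R x)
    = density lborel (isotropic_normal_density (a * \<sigma>))"
proof -
  let ?f = "\<lambda>\<sigma>. \<lambda>x::real^'d. ennreal (isotropic_normal_density \<sigma> x)"
  have lb: "(lborel :: (real^'d) measure) = density (distr lborel borel (\<lambda>x. a *\<^sub>R x)) (\<lambda>_. ennreal (a ^ CARD('d)))"
    using lborel_affine[of a "0::real^'d"] assms by simp
  have "density lborel (?f (a * \<sigma>))
      = density (density (distr lborel borel (\<lambda>x. a *\<^sub>R x)) (\<lambda>_. ennreal (a ^ CARD('d)))) (?f (a * \<sigma>))"
    by (subst lb) simp
  also have "\<dots> = density (distr lborel borel (\<lambda>x. a *\<^sub>R x)) (\<lambda>x. ennreal (a ^ CARD('d)) * ?f (a * \<sigma>) x)"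
    by (subst density_density_eq) auto
  also have "\<dots> = distr (density lborel (\<lambda>x. ennreal (a ^ CARD('d)) * ?f (a * \<sigma>) (a *\<^sub>R x))) borel (\<lambda>x. a *\<^sub>R x)"
    by (subst density_distr) auto
  also have "(\<lambda>x. ennreal (a ^ CARD('d)) * ?f (a * \<sigma>) (a *\<^sub>R x)) = ?f \<sigma>"
    using assms isotropic_normal_density_scale[OF \<open>a > 0\<close>, of \<sigma>, where 'd='d]
    by (simp add: fun_eq_iff flip: ennreal_mult')
  finally show ?thesis ..
qed

section \<open>Rescaled blocks of the path: independence and common law\<close>

context standard_brownian_motion
begin

definition grid_incr :: "real \<Rightarrow> nat \<Rightarrow> nat \<Rightarrow> 'a \<Rightarrow> real ^ 'd" where
  "grid_incr c n l \<omega> = (1 / sqrt c) *\<^sub>R (W (real (Suc l) / 2 ^ n * c) \<omega> - W (real l / 2 ^ n * c) \<omega>)"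

text \<open>For \<open>r\<close> in [0, 1] this is the path on the \<open>k\<close>-th interval of
  length \<open>c\<close>, restarted at 0 and brought to unit duration. The factor is the one of
  Brownian scaling, so that the law depends neither on \<open>c\<close> nor on
  \<open>k\<close>.\<close>

definition block :: "real \<Rightarrow> nat \<Rightarrow> real \<Rightarrow> 'a \<Rightarrow> real ^ 'd" where
  "block c k r \<omega> = (1 / sqrt c) *\<^sub>R (W ((real k + r) * c) \<omega> - W (real k * c) \<omega>)"

definition block_path :: "real \<Rightarrow> nat \<Rightarrow> 'a \<Rightarrow> real \<Rightarrow> real ^ 'd" where
  "block_path c k \<omega> = (\<lambda>d\<in>dyadics. block c k d \<omega>)"

abbreviation path_space :: "(real \<Rightarrow> real ^ 'd) measure" where
  "path_space \<equiv> PiM dyadics (\<lambda>_. borel)"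

lemma block_dyadic:
  assumes "i \<le> 2 ^ n"
  shows "block c k (real i / 2 ^ n) \<omega> = (\<Sum>l<i. grid_incr c n (k * 2 ^ n + l) \<omega>)"
proof -
  have "(\<Sum>l<i. grid_incr c n (k * 2 ^ n + l) \<omega>) =
     (1 / sqrt c) *\<^sub>R (\<Sum>l<i. W (real (k * 2 ^ n + Suc l) / 2 ^ n * c) \<omega> - W (real (k * 2 ^ n + l) / 2 ^ n * c) \<omega>)"
    by (simp add: grid_incr_def scaleR_sum_right)
  also have "\<dots> = (1 / sqrt c) *\<^sub>R (W (real (k * 2 ^ n + i) / 2 ^ n * c) \<omega> - W (real (k * 2 ^ n) / 2 ^ n * c) \<omega>)"
    by (subst sum_lessThan_telescope[of "\<lambda>l. W (real (k * 2 ^ n + l) / 2 ^ n * c) \<omega>"]) simp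
  finally show ?thesis
    by (simp add: block_def add_divide_distrib)
qed

lemma grid_incr_measurable:
  "c > 0 \<Longrightarrow> grid_incr c n l \<in> borel_measurable M"
  unfolding grid_incr_def by (intro borel_measurable_scaleR borel_measurable_diff measurable_W) auto

lemma block_measurable:
  "c > 0 \<Longrightarrow> r \<ge> 0 \<Longrightarrow> block c k r \<in> borel_measurable M"
  unfolding block_def by (intro borel_measurable_scaleR borel_measurable_diff measurable_W) auto

lemma block_path_measurable:
  "c > 0 \<Longrightarrow> block_path c k \<in> M \<rightarrow>\<^sub>M path_space"
  unfolding block_path_def
  by (intro measurable_restrict block_measurable) (auto dest: dyadics_bounds)

lemma grid_incr_distr:
  assumes "c > 0"
  shows "distr M borel (grid_incr c n l) = density lborel (isotropic_normal_density (sqrt (1 / 2 ^ n)))"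
proof -
  define X where "X \<omega> = W (real (Suc l) / 2 ^ n * c) \<omega> - W (real l / 2 ^ n * c) \<omega>" for \<omega>
  have eq: "real (Suc l) / 2 ^ n * c - real l / 2 ^ n * c = c * (1 / 2 ^ n)"
    by (simp add: field_simps)
  have X: "distributed M lborel X (\<lambda>x. ennreal (isotropic_normal_density (sqrt (c * (1 / 2 ^ n))) x))"
    unfolding X_def using assms by (subst eq[symmetric], intro normal_increments) (auto simp: divide_strict_right_mono)
  have Xm[measurable]: "X \<in> borel_measurable M"
    using X by (auto simp: distributed_def)
  have "distr M borel (grid_incr c n l) = distr (distr M lborel X) borel (\<lambda>x. (1 / sqrt c) *\<^sub>R x)"
    by (subst distr_distr) (auto simp: grid_incr_def[abs_def] X_def comp_def)
  also have "distr M lborel X = density lborel (isotropic_normal_density (sqrt (c * (1 / 2 ^ n))))"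
    using X by (auto simp: distributed_def)
  also have "distr \<dots> borel (\<lambda>x. (1 / sqrt c) *\<^sub>R x)
      = density lborel (isotropic_normal_density ((1 / sqrt c) * sqrt (c * (1 / 2 ^ n))))"
    using assms by (intro distr_isotropic_normal_scale) auto
  finally show ?thesis
    using assms by (simp add: real_sqrt_mult real_sqrt_divide)
qed

lemma grid_incr_indep:
  assumes "c > 0"
  shows "indep_vars (\<lambda>_. borel) (grid_incr c n) {..<N}"
proof -
  have "indep_vars (\<lambda>_. borel) (\<lambda>i \<omega>. W (real (Suc i) / 2 ^ n * c) \<omega> - W (real i / 2 ^ n * c) \<omega>) {..<N}"
    using assms by (intro independent_increments[of "\<lambda>i. real i / 2 ^ n * c"])
      (auto intro!: divide_right_mono mult_right_mono)
  then have "indep_vars (\<lambda>_. borel) (\<lambda>i \<omega>. (\<lambda>x. (1 / sqrt c) *\<^sub>R x) (W (real (Suc i) / 2 ^ n * c) \<omega> - W (real i / 2 ^ n * c) \<omega>)) {..<N}"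
    by (rule indep_vars_compose2) auto
  then show ?thesis
    by (simp add: grid_incr_def[abs_def])
qed

text \<open>By \<open>block_dyadic\<close> the values of a block at times of level \<open>n\<close>
  are partial sums of its \<open>2 ^ n\<close> grid increments, so a cylinder is an event about
  these increments. The floor recovers the numerator of \<open>d\<close> over
  \<open>2 ^ n\<close>.\<close>

lemma block_path_cylinder:
  assumes "c > 0" "finite J" "J \<subseteq> dyadics" "\<And>d. d \<in> J \<Longrightarrow> E d \<in> sets borel"
    and n: "\<forall>d\<in>J. \<exists>i\<le>2 ^ n. d = real i / 2 ^ n"
  defines "C \<equiv> {x \<in> space (PiM {..<2 ^ n} (\<lambda>_. borel)). \<forall>d\<in>J. (\<Sum>l<nat \<lfloor>d * 2 ^ n\<rfloor>. x l) \<in> E d}"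
  shows "C \<in> sets (PiM {..<2 ^ n} (\<lambda>_. borel))"
    and "block_path c k -` prod_emb dyadics (\<lambda>_. borel) J (Pi\<^sub>E J E) \<inter> space M
      = (\<lambda>\<omega>. \<lambda>l\<in>{..<2 ^ n}. grid_incr c n (k * 2 ^ n + l) \<omega>) -` C \<inter> space M"
proof -
  have le: "nat \<lfloor>d * 2 ^ n\<rfloor> \<le> 2 ^ n" and eq: "d = real (nat \<lfloor>d * 2 ^ n\<rfloor>) / 2 ^ n" if "d \<in> J" for d
    using n that by fastforce+
  have [measurable]: "(\<lambda>x. \<Sum>l<nat \<lfloor>d * 2 ^ n\<rfloor>. x l) \<in> PiM {..<2 ^ n} (\<lambda>_. borel) \<rightarrow>\<^sub>M (borel :: (real^'d) measure)" if "d \<in> J" for d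
    using le[OF that] by (intro borel_measurable_sum measurable_component_singleton) (metis lessThan_iff order_less_le_trans)
  have [measurable]: "\<And>d. d \<in> J \<Longrightarrow> E d \<in> sets borel" by fact
  show "C \<in> sets (PiM {..<2 ^ n} (\<lambda>_. borel))"
    unfolding C_def using \<open>finite J\<close> by measurable
  have sum: "block c k d \<omega> = (\<Sum>l<nat \<lfloor>d * 2 ^ n\<rfloor>. (\<lambda>l\<in>{..<2 ^ n}. grid_incr c n (k * 2 ^ n + l) \<omega>) l)" if "d \<in> J" for d \<omega>
    by (subst eq[OF that], subst block_dyadic[OF le[OF that]]) (use le[OF that] in \<open>intro sum.cong refl, metis lessThan_iff order_less_le_trans restrict_apply'\<close>)
  have "block_path c k \<omega> \<in> prod_emb dyadics (\<lambda>_. borel) J (Pi\<^sub>E J E) \<longleftrightarrow> (\<forall>d\<in>J. block c k d \<omega> \<in> E d)" for \<omega>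
    using \<open>J \<subseteq> dyadics\<close> by (auto simp: prod_emb_def block_path_def space_PiM PiE_iff)
  moreover have "(\<lambda>l\<in>{..<2 ^ n}. grid_incr c n (k * 2 ^ n + l) \<omega>) \<in> C \<longleftrightarrow> (\<forall>d\<in>J. block c k d \<omega> \<in> E d)" for \<omega>
    unfolding C_def by (simp add: space_PiM sum cong: ball_cong)
  ultimately show "block_path c k -` prod_emb dyadics (\<lambda>_. borel) J (Pi\<^sub>E J E) \<inter> space M
      = (\<lambda>\<omega>. \<lambda>l\<in>{..<2 ^ n}. grid_incr c n (k * 2 ^ n + l) \<omega>) -` C \<inter> space M"
    by auto
qed

text \<open>Cylinders form an intersection-stable generator. On a grid fine enough for all times
  involved, distinct blocks read disjoint batches of independent increments.\<close>

lemma block_path_indep: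
  assumes "c > 0" "N > 0"
  shows "indep_vars (\<lambda>_. path_space) (block_path c) {..<N}"
proof (subst indep_vars_finite[where E="\<lambda>_. prod_algebra dyadics (\<lambda>_. borel)"])
  show "{..<N} \<noteq> {}" "finite {..<N}"
    using assms by auto
  show "sets path_space = sigma_sets (space path_space) (prod_algebra dyadics (\<lambda>_. borel))"
    by (simp add: sets_PiM space_PiM)
  show "block_path c k \<in> M \<rightarrow>\<^sub>M path_space" for k
    using assms block_path_measurable by auto
  show "Int_stable (prod_algebra dyadics (\<lambda>_. borel))"
    by (rule Int_stable_prod_algebra)
  have "space path_space = prod_emb dyadics (\<lambda>_. borel) {0} (\<Pi>\<^sub>E d\<in>{0}. UNIV)"
    by (auto simp: prod_emb_def space_PiM PiE_iff)
  also have "\<dots> \<in> prod_algebra dyadics (\<lambda>_. borel)"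
    using dyadics_0 by (intro prod_algebraI) auto
  finally show "space path_space \<in> prod_algebra dyadics (\<lambda>_. borel)" .
  show "prod_algebra dyadics (\<lambda>_. borel) \<subseteq> Pow (space path_space)"
    using prod_algebra_sets_into_space[of dyadics "\<lambda>_. borel"] by (simp add: space_PiM)
  show "\<forall>A\<in>{..<N} \<rightarrow> prod_algebra dyadics (\<lambda>_. borel).
       prob (\<Inter>j\<in>{..<N}. block_path c j -` A j \<inter> space M) = (\<Prod>j\<in>{..<N}. prob (block_path c j -` A j \<inter> space M))"
  proof
    fix A :: "nat \<Rightarrow> (real \<Rightarrow> real ^ 'd) set"
    assume "A \<in> {..<N} \<rightarrow> prod_algebra dyadics (\<lambda>_. borel)"
    have "\<exists>J E. A k = prod_emb dyadics (\<lambda>_. borel) J (Pi\<^sub>E J E) \<and> finite J \<and> J \<subseteq> dyadics \<and> (\<forall>d\<in>J. E d \<in> sets borel)"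
      if "k < N" for k
    proof -
      have "A k \<in> prod_algebra dyadics (\<lambda>_. borel)"
        using \<open>A \<in> _\<close> that by auto
      then show ?thesis
        by (rule prod_algebraE) blast
    qed
    then obtain J E where A: "\<And>k. k < N \<Longrightarrow> A k = prod_emb dyadics (\<lambda>_. borel) (J k) (Pi\<^sub>E (J k) (E k))"
      and J: "\<And>k. k < N \<Longrightarrow> finite (J k)" "\<And>k. k < N \<Longrightarrow> J k \<subseteq> dyadics"
      and E: "\<And>k d. k < N \<Longrightarrow> d \<in> J k \<Longrightarrow> E k d \<in> sets borel"
      by metis
    have "finite (\<Union>k<N. J k)" "(\<Union>k<N. J k) \<subseteq> dyadics"
      using J by auto
    from dyadics_finite_subset_grid[OF this]
    obtain n where n: "\<forall>d\<in>(\<Union>k<N. J k). \<exists>i\<le>2 ^ n. d = real i / 2 ^ n"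
      by (elim exE allE impE) (rule order_refl)
    define V where "V k \<omega> = (\<lambda>l\<in>{..<2 ^ n}. grid_incr c n (k * 2 ^ n + l) \<omega>)" for k \<omega>
    define C where "C k = {x \<in> space (PiM {..<2 ^ n} (\<lambda>_. borel)). \<forall>d\<in>J k. (\<Sum>l<nat \<lfloor>d * 2 ^ n\<rfloor>. x l) \<in> E k d}" for k
    have C: "C k \<in> sets (PiM {..<2 ^ n} (\<lambda>_. borel))"
      and eq: "block_path c k -` A k \<inter> space M = V k -` C k \<inter> space M" if "k < N" for k
    proof -
      have nk: "\<forall>d\<in>J k. \<exists>i\<le>2 ^ n. d = real i / 2 ^ n"
        using n that by blast
      note * = block_path_cylinder[OF \<open>c > 0\<close> J[OF that] E[OF that] nk]
      show "C k \<in> sets (PiM {..<2 ^ n} (\<lambda>_. borel))"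
        unfolding C_def by (rule *(1))
      show "block_path c k -` A k \<inter> space M = V k -` C k \<inter> space M"
        unfolding C_def V_def A[OF that] by (rule *(2))
    qed
    let ?K = "\<lambda>k::nat. {k * 2 ^ n..<k * 2 ^ n + 2 ^ n}"
    have "indep_vars (\<lambda>k. PiM (?K k) (\<lambda>_. borel)) (\<lambda>k \<omega>. restrict (\<lambda>l. grid_incr c n l \<omega>) (?K k)) {..<N}"
    proof (rule indep_vars_restrict[OF grid_incr_indep[OF \<open>c > 0\<close>, of n "N * 2 ^ n"]])
      fix k assume "k \<in> {..<N}"
      then have "Suc k * 2 ^ n \<le> N * 2 ^ n"
        by (intro mult_right_mono) auto
      then show "?K k \<subseteq> {..<N * 2 ^ n}"
        by auto
    next
      show "disjoint_family_on ?K {..<N}"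
      proof (unfold disjoint_family_on_def, intro ballI impI)
        fix k k' :: nat assume "k \<noteq> k'"
        then have "Suc k \<le> k' \<or> Suc k' \<le> k" by auto
        then have "Suc k * 2 ^ n \<le> k' * 2 ^ n \<or> Suc k' * 2 ^ n \<le> k * 2 ^ n"
          by (meson mult_right_mono zero_le)
        then show "?K k \<inter> ?K k' = {}"
          by auto
      qed
    qed
    \<comment> \<open>Shifting the indices of each batch to start at 0 makes \<open>V k\<close> a
      vector of the form that \<open>C k\<close> constrains.\<close>
    then have "indep_vars (\<lambda>k. PiM {..<2 ^ n} (\<lambda>_. borel))
        (\<lambda>k \<omega>. (\<lambda>x. \<lambda>l\<in>{..<2 ^ n}. x (k * 2 ^ n + l)) (restrict (\<lambda>l. grid_incr c n l \<omega>) (?K k))) {..<N}"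
      by (rule indep_vars_compose2) (intro measurable_restrict measurable_component_singleton, auto)
    also have "(\<lambda>k \<omega>. (\<lambda>x. \<lambda>l\<in>{..<2 ^ n}. x (k * 2 ^ n + l)) (restrict (\<lambda>l. grid_incr c n l \<omega>) (?K k))) = V"
      by (auto simp: V_def fun_eq_iff restrict_def)
    finally have V: "indep_vars (\<lambda>k. PiM {..<2 ^ n} (\<lambda>_. borel)) V {..<N}" .
    show "prob (\<Inter>j\<in>{..<N}. block_path c j -` A j \<inter> space M) = (\<Prod>j\<in>{..<N}. prob (block_path c j -` A j \<inter> space M))"
      using indep_varsD_finite[OF V, of C] C eq assms by auto
  qed
qed

lemma grid_incr_vector_law:
  assumes "c > 0" "m > 0"
  shows "distr M (PiM {..<m} (\<lambda>_. borel)) (\<lambda>\<omega>. \<lambda>l\<in>{..<m}. grid_incr c n (k + l) \<omega>)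
    = PiM {..<m} (\<lambda>_. density lborel (isotropic_normal_density (sqrt (1 / 2 ^ n))))"
proof -
  have False': "{..<m} \<noteq> {}" using assms by auto
  have "indep_vars (\<lambda>_. borel) (\<lambda>i \<omega>. W (real (k + Suc i) / 2 ^ n * c) \<omega> - W (real (k + i) / 2 ^ n * c) \<omega>) {..<m}"
    using assms by (intro independent_increments[of "\<lambda>i. real (k + i) / 2 ^ n * c"])
      (auto intro!: divide_right_mono mult_right_mono)
  then have "indep_vars (\<lambda>_. borel) (\<lambda>i \<omega>. (\<lambda>x. (1 / sqrt c) *\<^sub>R x) (W (real (k + Suc i) / 2 ^ n * c) \<omega> - W (real (k + i) / 2 ^ n * c) \<omega>)) {..<m}"
    by (rule indep_vars_compose2) auto
  then have "indep_vars (\<lambda>_. borel) (\<lambda>l. grid_incr c n (k + l)) {..<m}"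
    by (simp add: grid_incr_def[abs_def])
  then show ?thesis
    using False' assms
    by (subst (asm) indep_vars_iff_distr_eq_PiM') (auto simp: grid_incr_distr grid_incr_measurable)
qed

text \<open>Brownian scaling together with stationarity: a cylinder probability is computed from
  \<open>2 ^ n\<close> independent Gaussian vectors of variance \<open>1 / 2 ^ n\<close>, and
  neither the duration nor the position of the block enters.\<close>

lemma block_path_law:
  assumes "c > 0" "c' > 0"
  shows "distr M path_space (block_path c k) = distr M path_space (block_path c' k')"
proof (rule measure_eqI_PiM_infinite)
  note [measurable] = block_path_measurable
  interpret D: prob_space "distr M path_space (block_path c k)"
    using assms by (intro prob_space_distr block_path_measurable)
  show "finite_measure (distr M path_space (block_path c k))"
    by unfold_locales
  fix E :: "real \<Rightarrow> (real ^ 'd) set" and J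
  assume J: "finite J" "J \<subseteq> dyadics" "\<And>d. d \<in> J \<Longrightarrow> E d \<in> sets borel"
  obtain n where n: "\<forall>d\<in>J. \<exists>i\<le>2 ^ n. d = real i / 2 ^ n"
    using dyadics_finite_subset_grid[of J] J by auto
  have P: "prod_emb dyadics (\<lambda>_. borel) J (Pi\<^sub>E J E) \<in> sets path_space"
    using J by (intro sets_PiM_I) auto
  define C where "C = {x \<in> space (PiM {..<2 ^ n} (\<lambda>_. borel)). \<forall>d\<in>J. (\<Sum>l<nat \<lfloor>d * 2 ^ n\<rfloor>. x l) \<in> E d}"
  have [measurable]: "C \<in> sets (PiM {..<2 ^ n} (\<lambda>_. borel))"
    unfolding C_def using block_path_cylinder(1)[OF assms(1) J n] .
  have "emeasure (distr M path_space (block_path a j)) (prod_emb dyadics (\<lambda>_. borel) J (Pi\<^sub>E J E))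
      = emeasure (PiM {..<2 ^ n} (\<lambda>_. density lborel (isotropic_normal_density (sqrt (1 / 2 ^ n))))) C"
    if "a > 0" for a j
  proof -
    have [measurable]: "(\<lambda>\<omega>. \<lambda>l\<in>{..<2 ^ n}. grid_incr a n (j * 2 ^ n + l) \<omega>) \<in> M \<rightarrow>\<^sub>M PiM {..<2 ^ n} (\<lambda>_. borel)"
      using that by (intro measurable_restrict grid_incr_measurable)
    have "emeasure (distr M path_space (block_path a j)) (prod_emb dyadics (\<lambda>_. borel) J (Pi\<^sub>E J E))
        = emeasure M ((\<lambda>\<omega>. \<lambda>l\<in>{..<2 ^ n}. grid_incr a n (j * 2 ^ n + l) \<omega>) -` C \<inter> space M)"
      using block_path_cylinder(2)[OF that J n, where k=j] that P
      by (subst emeasure_distr) (auto simp: C_def)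
    also have "\<dots> = emeasure (distr M (PiM {..<2 ^ n} (\<lambda>_. borel)) (\<lambda>\<omega>. \<lambda>l\<in>{..<2 ^ n}. grid_incr a n (j * 2 ^ n + l) \<omega>)) C"
      by (subst emeasure_distr) auto
    finally show ?thesis
      using grid_incr_vector_law[OF that, of "2 ^ n" n "j * 2 ^ n"] by simp
  qed
  then show "emeasure (distr M path_space (block_path c k)) (prod_emb dyadics (\<lambda>_. borel) J (Pi\<^sub>E J E))
    = emeasure (distr M path_space (block_path c' k')) (prod_emb dyadics (\<lambda>_. borel) J (Pi\<^sub>E J E))"
    using assms by simp
qed auto

end

section \<open>Chaining\<close>

text \<open>The integrand factorises over the coordinates into one-dimensional Gaussian integrals.
  The power 12 is the dimension of \<open>space12\<close>, where the volume of a ball grows like the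
  twelfth power of its radius.\<close>

lemma isotropic_normal_coordinate_moment:
  fixes i :: "'d::finite"
  shows "(\<integral>\<^sup>+x. ennreal (isotropic_normal_density 1 x * (x $ i) ^ 12) \<partial>(lborel :: (real^'d) measure)) < \<infinity>"
proof -
  define f :: "real^'d \<Rightarrow> real \<Rightarrow> ennreal" where
    "f b y = (if b = axis i 1 then ennreal (std_normal_density y * y ^ 12) else ennreal (std_normal_density y))" for b y
  have inj: "inj_on (\<lambda>k::'d. axis k (1::real)) UNIV"
    by (auto simp: inj_on_def axis_eq_axis)
  have B: "Basis = (\<lambda>k::'d. axis k (1::real)) ` UNIV"
    by (auto simp: Basis_vec_def)
  have "ennreal (isotropic_normal_density 1 x * (x $ i) ^ 12) = (\<Prod>b\<in>Basis. f b (x \<bullet> b))" for x :: "real^'d"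
  proof -
    have "(\<Prod>b\<in>Basis. f b (x \<bullet> b)) = (\<Prod>k\<in>UNIV. f (axis k 1) (x $ k))"
      unfolding B by (subst prod.reindex[OF inj]) (simp add: inner_axis)
    also have "\<dots> = f (axis i 1) (x $ i) * (\<Prod>k\<in>UNIV - {i}. f (axis k 1) (x $ k))"
      by (subst prod.remove[of _ i]) auto
    also have "(\<Prod>k\<in>UNIV - {i}. f (axis k 1) (x $ k)) = (\<Prod>k\<in>UNIV - {i}. ennreal (std_normal_density (x $ k)))"
      by (intro prod.cong) (auto simp: f_def axis_eq_axis)
    also have "\<dots> = ennreal (\<Prod>k\<in>UNIV - {i}. std_normal_density (x $ k))"
      by (intro prod_ennreal) (auto simp: normal_density_nonneg)
    also have "f (axis i 1) (x $ i) * \<dots> = ennreal (std_normal_density (x $ i) * (x $ i) ^ 12 * (\<Prod>k\<in>UNIV - {i}. std_normal_density (x $ k)))"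
      by (simp add: f_def ennreal_mult' zero_le_mult_iff normal_density_nonneg)
    also have "std_normal_density (x $ i) * (x $ i) ^ 12 * (\<Prod>k\<in>UNIV - {i}. std_normal_density (x $ k)) = isotropic_normal_density 1 x * (x $ i) ^ 12"
      unfolding isotropic_normal_density_def by (subst (2) prod.remove[of _ i]) auto
    finally show ?thesis ..
  qed
  then have "(\<integral>\<^sup>+x. ennreal (isotropic_normal_density 1 x * (x $ i) ^ 12) \<partial>(lborel :: (real^'d) measure))
      = (\<integral>\<^sup>+x. (\<Prod>b\<in>Basis. f b (x \<bullet> b)) \<partial>lborel)"
    by simp
  also have "\<dots> = (\<Prod>b\<in>Basis. \<integral>\<^sup>+y. f b y \<partial>lborel)"
    by (intro nn_integral_lborel_prod) (auto simp: f_def)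
  also have "\<dots> < \<infinity>"
  proof -
    have "(\<integral>\<^sup>+y. ennreal (std_normal_density y) \<partial>lborel) < \<infinity>"
      by (subst nn_integral_eq_integral) auto
    moreover have "(\<integral>\<^sup>+y. ennreal (std_normal_density y * y ^ 12) \<partial>lborel) < \<infinity>"
      using integrable_std_normal_moment[of 12]
      by (subst nn_integral_eq_integral) (auto simp: zero_le_mult_iff normal_density_nonneg)
    ultimately have "(\<integral>\<^sup>+y. f b y \<partial>lborel) < \<infinity>" for b
      by (cases "b = axis i 1") (simp_all add: f_def)
    then show ?thesis
      by (simp add: less_top[symmetric] ennreal_prod_eq_top)
  qed
  finally show ?thesis .
qed

text \<open>The norm is at most the number of coordinates times the largest one, and the power of
  the largest one is a term of the sum.\<close>

lemma norm_power_le_sum_coordinates: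
  fixes x :: "real^'d"
  shows "norm x ^ p \<le> real CARD('d) ^ p * (\<Sum>i\<in>UNIV. \<bar>x $ i\<bar> ^ p)"
proof -
  define m where "m = Max (range (\<lambda>i. \<bar>x $ i\<bar>))"
  have m: "\<bar>x $ i\<bar> \<le> m" for i
    unfolding m_def by (intro Max_ge) auto
  have "m \<in> range (\<lambda>i. \<bar>x $ i\<bar>)"
    unfolding m_def by (intro Max_in) auto
  then obtain i where i: "m = \<bar>x $ i\<bar>" by auto
  have "norm x \<le> (\<Sum>i\<in>UNIV. \<bar>x $ i\<bar>)"
    by (rule norm_le_l1_cart)
  also have "\<dots> \<le> (\<Sum>i\<in>(UNIV::'d set). m)"
    by (intro sum_mono m)
  finally have "norm x ^ p \<le> (real CARD('d) * m) ^ p"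
    by (intro power_mono) auto
  also have "\<dots> = real CARD('d) ^ p * m ^ p"
    by (rule power_mult_distrib)
  also have "m ^ p \<le> (\<Sum>i\<in>UNIV. \<bar>x $ i\<bar> ^ p)"
    unfolding i by (rule member_le_sum) auto
  finally show ?thesis
    by (simp add: mult_left_mono)
qed

lemma isotropic_normal_norm_moment:
  "(\<integral>\<^sup>+x. ennreal (norm x ^ 12) \<partial>density (lborel :: (real^'d) measure) (isotropic_normal_density 1)) < \<infinity>"
proof -
  have nn: "isotropic_normal_density 1 x \<ge> 0" for x :: "real^'d"
    by (intro less_imp_le isotropic_normal_density_pos) simp
  have "(\<integral>\<^sup>+x. ennreal (norm x ^ 12) \<partial>density (lborel :: (real^'d) measure) (isotropic_normal_density 1))
      = (\<integral>\<^sup>+x. ennreal (isotropic_normal_density 1 x * norm x ^ 12) \<partial>(lborel :: (real^'d) measure))"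
    using nn by (subst nn_integral_density) (auto simp: ennreal_mult')
  also have "\<dots> \<le> (\<integral>\<^sup>+x. (\<Sum>i\<in>UNIV. ennreal (real CARD('d) ^ 12) * ennreal (isotropic_normal_density 1 x * (x $ i) ^ 12)) \<partial>(lborel :: (real^'d) measure))"
  proof (intro nn_integral_mono)
    fix x :: "real^'d"
    have "isotropic_normal_density 1 x * norm x ^ 12 \<le> isotropic_normal_density 1 x * (real CARD('d) ^ 12 * (\<Sum>i\<in>UNIV. \<bar>x $ i\<bar> ^ 12))"
      using nn by (intro mult_left_mono norm_power_le_sum_coordinates)
    also have "\<dots> = (\<Sum>i\<in>UNIV. real CARD('d) ^ 12 * (isotropic_normal_density 1 x * (x $ i) ^ 12))"
      by (simp add: sum_distrib_left power_even_abs ac_simps)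
    finally have "ennreal (isotropic_normal_density 1 x * norm x ^ 12) \<le> ennreal \<dots>"
      by (rule ennreal_leI)
    also have "\<dots> = (\<Sum>i\<in>UNIV. ennreal (real CARD('d) ^ 12) * ennreal (isotropic_normal_density 1 x * (x $ i) ^ 12))"
      using nn by (subst sum_ennreal[symmetric]) (auto simp: ennreal_mult' intro!: mult_nonneg_nonneg)
    finally show "ennreal (isotropic_normal_density 1 x * norm x ^ 12) \<le> \<dots>" .
  qed
  also have "\<dots> = (\<Sum>i\<in>UNIV. ennreal (real CARD('d) ^ 12) * (\<integral>\<^sup>+x. ennreal (isotropic_normal_density 1 x * (x $ i) ^ 12) \<partial>(lborel :: (real^'d) measure)))"
    by (subst nn_integral_sum) (auto simp: nn_integral_cmult)
  also have "\<dots> < \<infinity>"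
    using isotropic_normal_coordinate_moment[where 'd='d]
    by (auto simp: ennreal_mult_less_top)
  finally show ?thesis .
qed

context standard_brownian_motion
begin

lemma block_refine:
  "block c k (real (2 * i) / 2 ^ Suc n) \<omega> = block c k (real i / 2 ^ n) \<omega>"
  by simp

lemma block_refine_odd:
  assumes "2 * i + 1 \<le> 2 ^ Suc n"
  shows "block c k (real (2 * i + 1) / 2 ^ Suc n) \<omega>
    = block c k (real i / 2 ^ n) \<omega> + grid_incr c (Suc n) (k * 2 ^ Suc n + 2 * i) \<omega>"
  using assms block_dyadic[of "2 * i + 1" "Suc n" c k \<omega>] block_dyadic[of "2 * i" "Suc n" c k \<omega>]
  unfolding block_refine by simp

text \<open>Chaining: a grid point of level \<open>n + 1\<close> either lies on level
  \<open>n\<close> already or is one increment of level \<open>n + 1\<close> to the right of such a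
  point. So every level contributes at most one increment.\<close>

lemma norm_block_le_chain:
  assumes "\<And>l m. l \<le> n \<Longrightarrow> m < 2 ^ l \<Longrightarrow> norm (grid_incr c l (k * 2 ^ l + m) \<omega>) \<le> y l" "\<And>l. y l \<ge> 0"
  assumes "i \<le> 2 ^ n"
  shows "norm (block c k (real i / 2 ^ n) \<omega>) \<le> (\<Sum>l\<le>n. y l)"
  using assms(1,3)
proof (induction n arbitrary: i)
  case 0
  then have "i = 0 \<or> i = 1" by auto
  with 0 show ?case
    using block_dyadic[of i 0 c k \<omega>] assms(2)[of 0] by auto
next
  case (Suc n)
  obtain i' where i': "i = 2 * i' \<or> i = 2 * i' + 1"
    by (metis Suc_eq_plus1 oddE evenE)
  have IH: "norm (block c k (real i' / 2 ^ n) \<omega>) \<le> (\<Sum>l\<le>n. y l)"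
    using i' Suc.prems by (intro Suc.IH) auto
  from i' show ?case
  proof
    assume i: "i = 2 * i'"
    show ?thesis
      unfolding i block_refine using IH assms(2)[of "Suc n"] by simp
  next
    assume i: "i = 2 * i' + 1"
    have "norm (block c k (real i' / 2 ^ n) \<omega> + grid_incr c (Suc n) (k * 2 ^ Suc n + 2 * i') \<omega>)
        \<le> (\<Sum>l\<le>n. y l) + y (Suc n)"
      using i Suc.prems(2) by (intro norm_triangle_mono IH Suc.prems(1)) auto
    then show ?thesis
      unfolding i using Suc.prems(2) i by (subst block_refine_odd) auto
  qed
qed

text \<open>
  The increments of level \<open>l\<close> have twelfth moment of order \<open>2 ^ (- 6 * l)\<close> and there are \<open>2 ^ l\<close> of them,
  so the expectation converges because \<open>(5 / 4) ^ 12 < 2 ^ 5\<close>.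
\<close>

definition chain_sum :: "real \<Rightarrow> nat \<Rightarrow> 'a \<Rightarrow> ennreal" where
  "chain_sum c k \<omega> = (\<Sum>l. \<Sum>m<2 ^ l. ennreal ((5 / 4) ^ (12 * l) * norm (grid_incr c l (k * 2 ^ l + m) \<omega>) ^ 12))"

text \<open>A single term of \<open>chain_sum\<close> bounds an increment of level \<open>l\<close>
  by \<open>(4 / 5) ^ l\<close> times the twelfth root. Chaining then adds up a geometric series
  with sum 5.\<close>

lemma norm_block_le_chain_sum:
  assumes "chain_sum c k \<omega> < \<infinity>" "d \<in> dyadics"
  shows "norm (block c k d \<omega>) \<le> 5 * root 12 (enn2real (chain_sum c k \<omega>))"
proof -
  let ?V = "enn2real (chain_sum c k \<omega>)"
  obtain i n where d: "d = real i / 2 ^ n" "i \<le> 2 ^ n"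
    using assms by (auto simp: dyadics_def)
  have b: "norm (grid_incr c l (k * 2 ^ l + m) \<omega>) \<le> (4 / 5) ^ l * root 12 ?V" if "m < 2 ^ l" for l m
  proof -
    have "ennreal ((5 / 4) ^ (12 * l) * norm (grid_incr c l (k * 2 ^ l + m) \<omega>) ^ 12)
        \<le> (\<Sum>m<2 ^ l. ennreal ((5 / 4) ^ (12 * l) * norm (grid_incr c l (k * 2 ^ l + m) \<omega>) ^ 12))"
      using that by (intro member_le_sum) auto
    also have "\<dots> \<le> (\<Sum>l\<in>{l}. \<Sum>m<2 ^ l. ennreal ((5 / 4) ^ (12 * l) * norm (grid_incr c l (k * 2 ^ l + m) \<omega>) ^ 12))"
      by simp
    also have "\<dots> \<le> chain_sum c k \<omega>"
      unfolding chain_sum_def by (intro sum_le_suminf) auto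
    also have "\<dots> = ennreal ?V"
      using assms by simp
    finally have "((5 / 4) ^ l * norm (grid_incr c l (k * 2 ^ l + m) \<omega>)) ^ 12 \<le> ?V"
      by (subst (asm) ennreal_le_iff) (auto simp: power_mult_distrib power_mult[symmetric] ac_simps)
    then have "root 12 (((5 / 4) ^ l * norm (grid_incr c l (k * 2 ^ l + m) \<omega>)) ^ 12) \<le> root 12 ?V"
      by simp
    then have "(5 / 4) ^ l * norm (grid_incr c l (k * 2 ^ l + m) \<omega>) \<le> root 12 ?V"
      by (simp add: real_root_power_cancel)
    then show ?thesis
      by (simp add: field_simps)
  qed
  have "norm (block c k d \<omega>) \<le> (\<Sum>l\<le>n. (4 / 5) ^ l * root 12 ?V)"
    unfolding d(1) using b d(2) by (intro norm_block_le_chain) auto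
  also have "\<dots> = (\<Sum>l\<le>n. (4 / 5) ^ l) * root 12 ?V"
    by (simp add: sum_distrib_right)
  also have "\<dots> \<le> 5 * root 12 ?V"
  proof (intro mult_right_mono)
    have "(\<Sum>l\<le>n. (4 / 5 :: real) ^ l) \<le> (\<Sum>l. (4 / 5) ^ l)"
      by (intro sum_le_suminf summable_geometric) auto
    also have "\<dots> = 5"
      by (subst suminf_geometric) auto
    finally show "(\<Sum>l\<le>n. (4 / 5 :: real) ^ l) \<le> 5" .
  qed simp
  finally show ?thesis .
qed

text \<open>The standard deviation is the square root of \<open>1 / 2 ^ n\<close>, and its twelfth
  power is \<open>(1 / 64) ^ n\<close>.\<close>

lemma grid_incr_moment:
  assumes "c > 0"
  shows "(\<integral>\<^sup>+\<omega>. ennreal (norm (grid_incr c n l \<omega>) ^ 12) \<partial>M)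
    = ennreal ((1 / 64) ^ n) * (\<integral>\<^sup>+x. ennreal (norm x ^ 12) \<partial>density (lborel :: (real^'d) measure) (isotropic_normal_density 1))"
proof -
  note [measurable] = grid_incr_measurable[OF assms, of n l]
  have "(\<integral>\<^sup>+\<omega>. ennreal (norm (grid_incr c n l \<omega>) ^ 12) \<partial>M)
      = (\<integral>\<^sup>+x. ennreal (norm x ^ 12) \<partial>distr M borel (grid_incr c n l))"
    by (subst nn_integral_distr) auto
  also have "distr M borel (grid_incr c n l) = density lborel (isotropic_normal_density (sqrt (1 / 2 ^ n) * 1))"
    using grid_incr_distr[OF assms] by simp
  also have "\<dots> = distr (density lborel (isotropic_normal_density 1)) borel (\<lambda>x. sqrt (1 / 2 ^ n) *\<^sub>R x)"
    by (subst distr_isotropic_normal_scale) auto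
  also have "(\<integral>\<^sup>+x. ennreal (norm x ^ 12) \<partial>\<dots>)
      = (\<integral>\<^sup>+x. ennreal ((1 / 64) ^ n) * ennreal (norm x ^ 12) \<partial>density (lborel :: (real^'d) measure) (isotropic_normal_density 1))"
  proof (subst nn_integral_distr)
    have "sqrt (1 / 2 ^ n) ^ 12 = (1 / 64) ^ n"
    proof -
      have "sqrt (1 / 2 ^ n) ^ (2 * 6) = (1 / 2 ^ n) ^ 6"
        by (subst power_mult) simp
      also have "\<dots> = ((1 / 2) ^ 6) ^ n"
        unfolding power_one_over[symmetric] power_mult[symmetric] by (simp only: mult.commute)
      also have "\<dots> = (1 / 64) ^ n"
        by (simp add: power_one_over)
      finally show ?thesis by simp
    qed
    then show "(\<integral>\<^sup>+x. ennreal (norm (sqrt (1 / 2 ^ n) *\<^sub>R x) ^ 12) \<partial>density (lborel :: (real^'d) measure) (isotropic_normal_density 1))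
      = (\<integral>\<^sup>+x. ennreal ((1 / 64) ^ n) * ennreal (norm x ^ 12) \<partial>density (lborel :: (real^'d) measure) (isotropic_normal_density 1))"
      by (simp add: power_mult_distrib ennreal_mult')
  qed auto
  also have "\<dots> = ennreal ((1 / 64) ^ n) * (\<integral>\<^sup>+x. ennreal (norm x ^ 12) \<partial>density (lborel :: (real^'d) measure) (isotropic_normal_density 1))"
    by (subst nn_integral_cmult) auto
  finally show ?thesis .
qed

lemma chain_sum_measurable: "c > 0 \<Longrightarrow> chain_sum c k \<in> borel_measurable M"
  unfolding chain_sum_def using grid_incr_measurable by measurable

lemma chain_sum_integral_finite:
  assumes "c > 0"
  shows "(\<integral>\<^sup>+\<omega>. chain_sum c k \<omega> \<partial>M) < \<infinity>"
proof -
  note [measurable] = grid_incr_measurable[OF assms]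
  define K where "K = (\<integral>\<^sup>+x. ennreal (norm x ^ 12) \<partial>density (lborel :: (real^'d) measure) (isotropic_normal_density 1))"
  \<comment> \<open>The ratio of consecutive levels, about 0.45: a factor 2 for the number of
    increments, \<open>(5 / 4) ^ 12\<close> for the weight and \<open>1 / 64\<close> for the
    moment.\<close>
  let ?q = "(5 / 4) ^ 12 / 32 :: real"
  have "(\<integral>\<^sup>+\<omega>. chain_sum c k \<omega> \<partial>M)
      = (\<Sum>l. \<Sum>m<2 ^ l. \<integral>\<^sup>+\<omega>. ennreal ((5 / 4) ^ (12 * l)) * ennreal (norm (grid_incr c l (k * 2 ^ l + m) \<omega>) ^ 12) \<partial>M)"
    unfolding chain_sum_def by (simp add: nn_integral_suminf nn_integral_sum ennreal_mult')
  also have "\<dots> = (\<Sum>l. \<Sum>m<(2::nat) ^ l. ennreal ((5 / 4) ^ (12 * l)) * (ennreal ((1 / 64) ^ l) * K))"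
    by (simp add: nn_integral_cmult grid_incr_moment[OF assms] K_def)
  also have "\<dots> = (\<Sum>l. ennreal (?q ^ l) * K)"
  proof (intro suminf_cong)
    fix l :: nat
    have "(2::real) ^ l * ((5 / 4) ^ (12 * l) * (1 / 64) ^ l) = (2 * ((5 / 4) ^ 12 * (1 / 64))) ^ l"
      by (simp only: power_mult power_mult_distrib)
    also have "2 * ((5 / 4) ^ 12 * (1 / 64)) = ?q"
      by simp
    finally have eq: "2 ^ l * ((5 / 4) ^ (12 * l) * (1 / 64) ^ l) = ?q ^ l" .
    have "(\<Sum>m<(2::nat) ^ l. ennreal ((5 / 4) ^ (12 * l)) * (ennreal ((1 / 64) ^ l) * K))
       = ennreal (2 ^ l) * (ennreal ((5 / 4) ^ (12 * l)) * (ennreal ((1 / 64) ^ l) * K))"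
      by (simp add: ennreal_power[symmetric])
    also have "\<dots> = ennreal (2 ^ l * ((5 / 4) ^ (12 * l) * (1 / 64) ^ l)) * K"
      by (simp add: ennreal_mult' mult.assoc)
    finally show "(\<Sum>m<(2::nat) ^ l. ennreal ((5 / 4) ^ (12 * l)) * (ennreal ((1 / 64) ^ l) * K)) = ennreal (?q ^ l) * K"
      unfolding eq .
  qed
  also have "\<dots> = (\<Sum>l. ennreal (?q ^ l)) * K"
    by (rule ennreal_suminf_multc)
  also have "(\<Sum>l. ennreal (?q ^ l)) = ennreal (\<Sum>l. ?q ^ l)"
    by (intro suminf_ennreal2 summable_geometric) (auto simp: power_divide)
  also have "ennreal (\<Sum>l. ?q ^ l) * K < \<infinity>"
    using isotropic_normal_norm_moment[where 'd='d] by (simp add: K_def ennreal_mult_less_top)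
  finally show ?thesis .
qed

end

section \<open>Volume of the set of hit points\<close>

text \<open>Closedness of the set and of its image allows passing to \<open>lebesgue\<close> and
  back.\<close>

lemma emeasure_lborel_affine_image:
  fixes S :: "'n::euclidean_space set"
  assumes "closed S"
  shows "emeasure lborel ((\<lambda>x. a + r *\<^sub>R x) ` S) = ennreal (\<bar>r\<bar> ^ DIM('n)) * emeasure lborel S"
proof -
  have "closed ((\<lambda>x. a + r *\<^sub>R x) ` S)"
    using closed_translation[OF closed_scaling[OF assms, of r], of a] by (simp add: image_image)
  then have "emeasure lborel ((\<lambda>x. a + r *\<^sub>R x) ` S) = emeasure lebesgue ((\<lambda>x. a + r *\<^sub>R x) ` S)"
    by simp
  also have "\<dots> = ennreal (\<bar>r\<bar> ^ DIM('n)) * emeasure lebesgue S"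
    using emeasure_lebesgue_affine[of r a S] by (simp add: add.commute)
  finally show ?thesis
    using assms by simp
qed

section \<open>Fubini arguments for translates and independent shifts\<close>

lemma lborel_distr_reflect:
  fixes a :: "'n::euclidean_space"
  shows "distr lborel borel (\<lambda>x. a - x) = lborel"
  using lborel_affine[of "-1" a] by (simp add: density_1)

text \<open>By Fubini and the invariance of Lebesgue measure under translation and reflection, the
  volume of the overlap of \<open>A\<close> with the translate of \<open>B\<close> by
  \<open>a + g\<close>, integrated over all \<open>g\<close>, is the product of the two
  volumes.\<close>

lemma AE_translates_null_imp:
  fixes A B :: "'n::euclidean_space set"
  assumes [measurable]: "A \<in> sets borel" "B \<in> sets borel"
  assumes null: "AE g in lborel. emeasure lborel {z \<in> A. z - (a + g) \<in> B} = 0"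
  shows "emeasure lborel A * emeasure lborel B = 0"
proof -
  have "0 = (\<integral>\<^sup>+g. emeasure lborel {z \<in> A. z - (a + g) \<in> B} \<partial>lborel)"
    using null by (subst nn_integral_cong_AE[of _ "\<lambda>_. 0"]) auto
  also have "\<dots> = (\<integral>\<^sup>+g. \<integral>\<^sup>+z. indicator A z * indicator B (z - (a + g)) \<partial>lborel \<partial>lborel)"
  proof (intro nn_integral_cong)
    fix g
    have "{z \<in> A. z - (a + g) \<in> B} \<in> sets borel"
      by measurable
    then have "emeasure lborel {z \<in> A. z - (a + g) \<in> B} = (\<integral>\<^sup>+z. indicator {z \<in> A. z - (a + g) \<in> B} z \<partial>lborel)"
      by simp
    also have "\<dots> = (\<integral>\<^sup>+z. indicator A z * indicator B (z - (a + g)) \<partial>lborel)"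
      by (intro nn_integral_cong) (auto simp: indicator_def)
    finally show "emeasure lborel {z \<in> A. z - (a + g) \<in> B} = \<dots>" .
  qed
  also have "\<dots> = (\<integral>\<^sup>+z. \<integral>\<^sup>+g. indicator A z * indicator B (z - (a + g)) \<partial>lborel \<partial>lborel)"
    by (rule lborel_pair.Fubini'[symmetric]) measurable
  also have "\<dots> = (\<integral>\<^sup>+z. indicator A z * emeasure lborel B \<partial>lborel)"
  proof (intro nn_integral_cong)
    fix z
    have "(\<integral>\<^sup>+g. indicator A z * indicator B (z - (a + g)) \<partial>lborel) = indicator A z * (\<integral>\<^sup>+g. indicator B ((z - a) - g) \<partial>lborel)"
      by (subst nn_integral_cmult) (auto simp: diff_diff_eq)
    also have "(\<integral>\<^sup>+g. indicator B ((z - a) - g) \<partial>lborel) = (\<integral>\<^sup>+y. indicator B y \<partial>distr lborel borel (\<lambda>g. (z - a) - g))"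
      by (subst nn_integral_distr) auto
    also have "\<dots> = emeasure lborel B"
      unfolding lborel_distr_reflect by simp
    finally show "(\<integral>\<^sup>+g. indicator A z * indicator B (z - (a + g)) \<partial>lborel) = indicator A z * emeasure lborel B" .
  qed
  also have "\<dots> = emeasure lborel A * emeasure lborel B"
    by (simp add: nn_integral_multc)
  finally show ?thesis ..
qed

lemma emeasure_lborel_Collect_measurable:
  fixes P :: "'x \<Rightarrow> 'n::euclidean_space \<Rightarrow> bool"
  assumes "Measurable.pred (N \<Otimes>\<^sub>M borel) (\<lambda>x. P (fst x) (snd x))"
  shows "(\<lambda>x. emeasure lborel {z. P x z}) \<in> borel_measurable N"
proof -
  have [measurable]: "Measurable.pred (N \<Otimes>\<^sub>M lborel) (\<lambda>x. P (fst x) (snd x))"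
    using assms by measurable
  let ?Q = "{x \<in> space (N \<Otimes>\<^sub>M lborel). P (fst x) (snd x)}"
  have "?Q \<in> sets (N \<Otimes>\<^sub>M lborel)"
    by measurable
  then have "(\<lambda>x. emeasure lborel (Pair x -` ?Q)) \<in> borel_measurable N"
    by (rule lborel.measurable_emeasure_Pair)
  also have "?this \<longleftrightarrow> ?thesis"
    by (intro measurable_cong) (simp add: space_pair_measure vimage_def)
  finally show ?thesis .
qed

text \<open>The exceptional set is Borel, so the statement says that its volume is 0, and this
  volume is measurable in the parameter.\<close>

lemma AE_lborel_measurable:
  fixes P :: "'x \<Rightarrow> 'n::euclidean_space \<Rightarrow> bool"
  assumes [measurable]: "Measurable.pred (N \<Otimes>\<^sub>M borel) (\<lambda>x. P (fst x) (snd x))"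
  shows "Measurable.pred N (\<lambda>x. AE g in lborel. P x g)"
proof -
  have "(AE g in lborel. P x g) \<longleftrightarrow> emeasure lborel {g. \<not> P x g} = 0" if x: "x \<in> space N" for x
  proof (rule AE_iff_measurable)
    have "Measurable.pred borel (P x)"
      using measurable_compose_Pair1[OF x assms] by simp
    then show "{g. \<not> P x g} \<in> sets lborel"
      by simp
  qed simp
  moreover have "(\<lambda>x. emeasure lborel {g. \<not> P x g}) \<in> borel_measurable N"
    by (rule emeasure_lborel_Collect_measurable) measurable
  then have "Measurable.pred N (\<lambda>x. emeasure lborel {g. \<not> P x g} = 0)"
    by measurable
  ultimately show ?thesis
    by (simp cong: measurable_cong)
qed

text \<open>Disjoint groups of independent variables are independent, and so are functions of them.
  The product form of the law is what Fubini needs later.\<close>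

lemma (in prob_space) indep_vars_pair_law:
  assumes ind: "indep_vars M' X I" and AB: "A \<inter> B = {}" "A \<subseteq> I" "B \<subseteq> I"
    and f[measurable]: "f \<in> PiM A M' \<rightarrow>\<^sub>M N1" and g[measurable]: "g \<in> PiM B M' \<rightarrow>\<^sub>M N2"
  shows "distr M (N1 \<Otimes>\<^sub>M N2) (\<lambda>\<omega>. (f (\<lambda>i\<in>A. X i \<omega>), g (\<lambda>i\<in>B. X i \<omega>)))
    = distr M N1 (\<lambda>\<omega>. f (\<lambda>i\<in>A. X i \<omega>)) \<Otimes>\<^sub>M distr M N2 (\<lambda>\<omega>. g (\<lambda>i\<in>B. X i \<omega>))"
proof -
  let ?XA = "\<lambda>\<omega>. \<lambda>i\<in>A. X i \<omega>" and ?XB = "\<lambda>\<omega>. \<lambda>i\<in>B. X i \<omega>"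
  have iv: "indep_var (PiM A M') ?XA (PiM B M') ?XB"
    by (rule indep_var_restrict[OF ind AB])
  note [measurable] = indep_var_rv1[OF iv] indep_var_rv2[OF iv]
  interpret g: prob_space "distr (distr M (PiM B M') ?XB) N2 g"
    by (intro prob_space.prob_space_distr prob_space_distr) measurable
  have "distr M N1 (\<lambda>\<omega>. f (?XA \<omega>)) \<Otimes>\<^sub>M distr M N2 (\<lambda>\<omega>. g (?XB \<omega>))
      = distr (distr M (PiM A M') ?XA) N1 f \<Otimes>\<^sub>M distr (distr M (PiM B M') ?XB) N2 g"
    by (simp add: distr_distr comp_def)
  also have "\<dots> = distr (distr M (PiM A M') ?XA \<Otimes>\<^sub>M distr M (PiM B M') ?XB) (N1 \<Otimes>\<^sub>M N2) (\<lambda>(x, y). (f x, g y))"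
    by (rule pair_measure_distr) (measurable, unfold_locales)
  also have "distr M (PiM A M') ?XA \<Otimes>\<^sub>M distr M (PiM B M') ?XB = distr M (PiM A M' \<Otimes>\<^sub>M PiM B M') (\<lambda>\<omega>. (?XA \<omega>, ?XB \<omega>))"
    using iv by (simp add: indep_var_distribution_eq)
  also have "distr \<dots> (N1 \<Otimes>\<^sub>M N2) (\<lambda>(x, y). (f x, g y)) = distr M (N1 \<Otimes>\<^sub>M N2) (\<lambda>\<omega>. (f (?XA \<omega>), g (?XB \<omega>)))"
    by (subst distr_distr) (auto simp: comp_def)
  finally show ?thesis ..
qed

text \<open>A law with a positive density has the same null sets as Lebesgue measure, so by Fubini
  the independent vector \<open>G\<close> can be exchanged for Lebesgue-almost every
  \<open>g\<close>. One direction is used for overlaps, the other for avoiding a point.\<close>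

lemma (in prob_space) AE_indep_shift_iff:
  fixes G :: "'a \<Rightarrow> 'n::euclidean_space"
  assumes X[measurable]: "X \<in> M \<rightarrow>\<^sub>M N"
    and joint: "distr M (N \<Otimes>\<^sub>M borel) (\<lambda>\<omega>. (X \<omega>, G \<omega>)) = distr M N X \<Otimes>\<^sub>M distr M borel G"
    and G: "distributed M lborel G f" "\<And>g. f g > 0"
    and P: "Measurable.pred (N \<Otimes>\<^sub>M borel) (\<lambda>x. P (fst x) (snd x))"
  shows "(AE \<omega> in M. P (X \<omega>) (G \<omega>)) \<longleftrightarrow> (AE \<omega> in M. AE g in lborel. P (X \<omega>) g)"
proof -
  note [measurable] = P
  have [measurable]: "f \<in> borel_measurable borel" "G \<in> borel_measurable M"
    using G by (auto simp: distributed_def)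
  have d: "distr M borel G = density lborel f"
    using G by (auto simp: distributed_def cong: distr_cong)
  interpret X: prob_space "distr M N X" by (rule prob_space_distr) measurable
  interpret D: prob_space "distr M borel G" by (rule prob_space_distr) measurable
  interpret XD: pair_sigma_finite "distr M N X" "distr M borel G" ..
  have "(AE \<omega> in M. P (X \<omega>) (G \<omega>)) \<longleftrightarrow> (AE x in distr M (N \<Otimes>\<^sub>M borel) (\<lambda>\<omega>. (X \<omega>, G \<omega>)). P (fst x) (snd x))"
    by (subst AE_distr_iff) auto
  also have "distr M (N \<Otimes>\<^sub>M borel) (\<lambda>\<omega>. (X \<omega>, G \<omega>)) = distr M N X \<Otimes>\<^sub>M distr M borel G"
    by (rule joint)
  also have "(AE x in \<dots>. P (fst x) (snd x)) \<longleftrightarrow> (AE x in distr M N X. AE g in distr M borel G. P x g)"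
    by (rule XD.AE_pair_iff[symmetric]) measurable
  also have "\<dots> \<longleftrightarrow> (AE x in distr M N X. AE g in lborel. P x g)"
    unfolding d using G(2) by (subst AE_density) auto
  also have "\<dots> \<longleftrightarrow> (AE \<omega> in M. AE g in lborel. P (X \<omega>) g)"
    using AE_lborel_measurable[OF P] by (subst AE_distr_iff) auto
  finally show ?thesis .
qed

section \<open>The defect map of a progression and the set of its values on six segments\<close>

type_synonym space12 = "(real^3) \<times> (real^3) \<times> (real^3) \<times> (real^3)"

text \<open>The defect in the twelve equations, linear in the six points. Nested pairs model the
  space of dimension 12, so that Lebesgue measure on it is an iterated product and Gaussian
  densities can be composed factor by factor.\<close>

definition comb :: "(nat \<Rightarrow> real) \<Rightarrow> (nat \<Rightarrow> real) \<Rightarrow> (nat \<Rightarrow> real^3) \<Rightarrow> space12" where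
  "comb \<alpha> \<beta> x = (let y = (\<lambda>i. x i - \<alpha> i *\<^sub>R x 0 - \<beta> i *\<^sub>R x 1) in (y 2, y 3, y 4, y 5))"

lemma comb_add: "comb \<alpha> \<beta> (\<lambda>j. x j + y j) = comb \<alpha> \<beta> x + comb \<alpha> \<beta> y"
  by (simp add: comb_def algebra_simps)

lemma comb_scaleR: "comb \<alpha> \<beta> (\<lambda>j. c *\<^sub>R x j) = c *\<^sub>R comb \<alpha> \<beta> x"
  by (simp add: comb_def algebra_simps)

lemma comb_cong: "(\<And>j. j < 6 \<Longrightarrow> x j = y j) \<Longrightarrow> comb \<alpha> \<beta> x = comb \<alpha> \<beta> y"
  by (simp add: comb_def)

lemma comb_measurable [measurable (raw)]:
  assumes "\<And>j. j < 6 \<Longrightarrow> x j \<in> borel_measurable N"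
  shows "(\<lambda>\<omega>. comb \<alpha> \<beta> (\<lambda>j. x j \<omega>)) \<in> borel_measurable N"
proof -
  have [measurable]: "x 0 \<in> borel_measurable N" "x 1 \<in> borel_measurable N" "x (Suc 0) \<in> borel_measurable N" "x 2 \<in> borel_measurable N"
    "x 3 \<in> borel_measurable N" "x 4 \<in> borel_measurable N" "x 5 \<in> borel_measurable N"
    by (auto intro: assms)
  show ?thesis
    unfolding comb_def Let_def by (intro borel_measurable_Pair) measurable
qed

lemma norm_comb_le:
  assumes "\<And>j. j < 6 \<Longrightarrow> norm (x j) \<le> r"
  shows "norm (comb \<alpha> \<beta> x) \<le> (\<Sum>i\<in>{2..5}. 1 + \<bar>\<alpha> i\<bar> + \<bar>\<beta> i\<bar>) * r"
proof -
  define y where "y i = x i - \<alpha> i *\<^sub>R x 0 - \<beta> i *\<^sub>R x 1" for i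
  have "norm (comb \<alpha> \<beta> x) \<le> (\<Sum>i\<in>{2..5}. norm (y i))"
  proof -
    have "norm (comb \<alpha> \<beta> x) = norm (y 2, y 3, y 4, y 5)"
      by (simp add: comb_def y_def)
    also have "\<dots> \<le> norm (y 2) + (norm (y 3) + (norm (y 4) + norm (y 5)))"
      by (meson norm_Pair_le add_left_mono order_trans)
    also have "\<dots> = (\<Sum>i\<in>{2..5}. norm (y i))"
      by (simp add: numeral_eq_Suc)
    finally show ?thesis .
  qed
  also have "\<dots> \<le> (\<Sum>i\<in>{2..5}. (1 + \<bar>\<alpha> i\<bar> + \<bar>\<beta> i\<bar>) * r)"
  proof (intro sum_mono)
    fix i :: nat assume "i \<in> {2..5}"
    have "norm (y i) \<le> norm (x i) + \<bar>\<alpha> i\<bar> * norm (x 0) + \<bar>\<beta> i\<bar> * norm (x 1)"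
      unfolding y_def by (rule order_trans[OF norm_triangle_ineq4], rule add_mono, rule order_trans[OF norm_triangle_ineq4]) auto
    also have "\<dots> \<le> r + \<bar>\<alpha> i\<bar> * r + \<bar>\<beta> i\<bar> * r"
      using \<open>i \<in> {2..5}\<close> by (intro add_mono mult_left_mono assms) auto
    finally show "norm (y i) \<le> (1 + \<bar>\<alpha> i\<bar> + \<bar>\<beta> i\<bar>) * r"
      by (simp add: algebra_simps)
  qed
  finally show ?thesis
    by (simp add: sum_distrib_right)
qed

abbreviation grid6 :: "(nat \<Rightarrow> real) set" where
  "grid6 \<equiv> {..<6} \<rightarrow>\<^sub>E dyadics"

text \<open>
  Taking the closure over dyadic times makes the set measurable in the path without
  using continuity.
\<close>

definition hits :: "(nat \<Rightarrow> real) \<Rightarrow> (nat \<Rightarrow> real) \<Rightarrow> (nat \<Rightarrow> real \<Rightarrow> real^3) \<Rightarrow> space12 set" where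
  "hits \<alpha> \<beta> b = closure ((\<lambda>d. comb \<alpha> \<beta> (\<lambda>j. b j (d j))) ` grid6)"

lemma closed_hits [simp]: "closed (hits \<alpha> \<beta> b)"
  by (simp add: hits_def)

lemma hits_borel [measurable]: "hits \<alpha> \<beta> b \<in> sets borel"
  by (intro borel_closed closed_hits)

lemma hits_cong:
  assumes "\<And>j d. j < 6 \<Longrightarrow> d \<in> dyadics \<Longrightarrow> b j d = b' j d"
  shows "hits \<alpha> \<beta> b = hits \<alpha> \<beta> b'"
  unfolding hits_def
  by (intro arg_cong[where f=closure] image_cong refl comb_cong) (auto intro!: assms)

lemma countable_grid6: "countable grid6"
  by (intro countable_PiE countable_dyadics) auto

text \<open>Membership in the closure of a countable set is a countable condition: for every radius
  \<open>inverse (Suc n)\<close> some point of an enumeration of \<open>grid6\<close> gives a value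
  within that distance of \<open>z\<close>.\<close>

lemma hits_pred_measurable [measurable (raw)]:
  assumes b[measurable]: "\<And>j. j < 6 \<Longrightarrow> (\<lambda>\<omega>. b \<omega> j) \<in> N \<rightarrow>\<^sub>M PiM dyadics (\<lambda>_. borel)"
    and z[measurable]: "z \<in> borel_measurable N"
  shows "Measurable.pred N (\<lambda>\<omega>. z \<omega> \<in> hits \<alpha> \<beta> (b \<omega>))"
proof -
  let ?e = "from_nat_into grid6"
  have ne: "grid6 \<noteq> {}"
    using dyadics_0 by (auto simp: PiE_eq_empty_iff)
  have e: "?e m \<in> grid6" for m
    using ne by (rule from_nat_into)
  have [measurable]: "(\<lambda>\<omega>. b \<omega> j (?e m j)) \<in> borel_measurable N" if "j < 6" for j m
    using e[of m] that by (intro measurable_compose[OF b measurable_component_singleton]) auto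
  have [measurable]: "(\<lambda>\<omega>. comb \<alpha> \<beta> (\<lambda>j. b \<omega> j (?e m j))) \<in> borel_measurable N" for m
    by (rule comb_measurable) measurable
  have "z \<omega> \<in> hits \<alpha> \<beta> (b \<omega>) \<longleftrightarrow> (\<forall>n::nat. \<exists>m. dist (comb \<alpha> \<beta> (\<lambda>j. b \<omega> j (?e m j))) (z \<omega>) < inverse (Suc n))" for \<omega>
  proof -
    have "z \<omega> \<in> hits \<alpha> \<beta> (b \<omega>) \<longleftrightarrow> (\<forall>\<epsilon>>0. \<exists>d\<in>grid6. dist (comb \<alpha> \<beta> (\<lambda>j. b \<omega> j (d j))) (z \<omega>) < \<epsilon>)"
      by (simp add: hits_def closure_approachable)
    also have "\<dots> \<longleftrightarrow> (\<forall>\<epsilon>>0. \<exists>m. dist (comb \<alpha> \<beta> (\<lambda>j. b \<omega> j (?e m j))) (z \<omega>) < \<epsilon>)"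
      using e from_nat_into_surj[OF countable_grid6] by (intro all_cong) metis
    also have "\<dots> \<longleftrightarrow> (\<forall>n::nat. \<exists>m. dist (comb \<alpha> \<beta> (\<lambda>j. b \<omega> j (?e m j))) (z \<omega>) < inverse (Suc n))"
    proof (intro iffI allI impI)
      fix \<epsilon> :: real
      assume *: "\<forall>n::nat. \<exists>m. dist (comb \<alpha> \<beta> (\<lambda>j. b \<omega> j (?e m j))) (z \<omega>) < inverse (Suc n)" and "\<epsilon> > 0"
      then obtain n where "inverse (real (Suc n)) < \<epsilon>"
        using reals_Archimedean by blast
      then show "\<exists>m. dist (comb \<alpha> \<beta> (\<lambda>j. b \<omega> j (?e m j))) (z \<omega>) < \<epsilon>"
        using *[rule_format, of n] by (blast intro: less_trans)
    qed simp
    finally show ?thesis .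
  qed
  then show ?thesis
    by simp
qed

lemma emeasure_hits_measurable [measurable (raw)]:
  assumes [measurable]: "\<And>j. j < 6 \<Longrightarrow> (\<lambda>\<omega>. b \<omega> j) \<in> N \<rightarrow>\<^sub>M PiM dyadics (\<lambda>_. borel)"
  shows "(\<lambda>\<omega>. emeasure lborel (hits \<alpha> \<beta> (b \<omega>))) \<in> borel_measurable N"
  using emeasure_lborel_Collect_measurable[where N=N and P="\<lambda>\<omega> z. z \<in> hits \<alpha> \<beta> (b \<omega>)"] by simp

text \<open>The values lie in a closed ball whose radius comes from \<open>norm_comb_le\<close>, and
  the closure stays in it.\<close>

lemma emeasure_hits_le:
  assumes "\<And>j d. j < 6 \<Longrightarrow> d \<in> dyadics \<Longrightarrow> norm (b j d) \<le> r"
  shows "emeasure lborel (hits \<alpha> \<beta> b)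
    \<le> ennreal (unit_ball_vol 12 * ((\<Sum>i\<in>{2..5}. 1 + \<bar>\<alpha> i\<bar> + \<bar>\<beta> i\<bar>) * r) ^ 12)"
proof -
  let ?R = "(\<Sum>i\<in>{2..5}. 1 + \<bar>\<alpha> i\<bar> + \<bar>\<beta> i\<bar>) * r"
  have "0 \<le> norm (b 0 0)" by simp
  also have "\<dots> \<le> r"
    using dyadics_0 by (intro assms) auto
  finally have "0 \<le> ?R"
    by (intro mult_nonneg_nonneg sum_nonneg) auto
  have "hits \<alpha> \<beta> b \<subseteq> cball 0 ?R"
    unfolding hits_def
  proof (rule closure_minimal)
    show "(\<lambda>d. comb \<alpha> \<beta> (\<lambda>j. b j (d j))) ` grid6 \<subseteq> cball 0 ?R"
      using assms by (auto simp: PiE_iff intro!: norm_comb_le)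
  qed simp
  then have "emeasure lborel (hits \<alpha> \<beta> b) \<le> emeasure lborel (cball (0::space12) ?R)"
    by (intro emeasure_mono) auto
  also have "\<dots> = ennreal (unit_ball_vol 12 * ?R ^ 12)"
    using emeasure_cball[OF \<open>0 \<le> ?R\<close>, of "0::space12"] by simp
  finally show ?thesis .
qed

section \<open>Independent Gaussian displacements\<close>

text \<open>Division with remainder of the tripled numerator: it tells in which third of a tripled
  block a time falls and where inside that third.\<close>

lemma dyadics_times_3:
  assumes "d \<in> dyadics"
  shows "\<exists>i<3. \<exists>d'\<in>dyadics. 3 * d = real i + d'"
proof -
  obtain a n where d: "d = real a / 2 ^ n" "a \<le> 2 ^ n"
    using assms by (auto simp: dyadics_def)
  show ?thesis
  proof (cases "a = 2 ^ n")
    \<comment> \<open>The right endpoint is counted as the end of the last third; plain division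
      would give the quotient 3.\<close>
    case True
    then show ?thesis
      using d dyadics_1 by (intro exI[of _ 2] conjI bexI[of _ 1]) auto
  next
    case False
    with d have "3 * a < 3 * 2 ^ n" by simp
    then have "3 * a div 2 ^ n < 3"
      by (simp add: less_mult_imp_div_less)
    moreover have "real (3 * a mod 2 ^ n) / 2 ^ n \<in> dyadics"
      by (intro dyadicsI) (simp add: less_imp_le)
    moreover have "3 * d = real (3 * a div 2 ^ n) + real (3 * a mod 2 ^ n) / 2 ^ n"
    proof -
      have "real (3 * a) = real (3 * a div 2 ^ n * 2 ^ n + 3 * a mod 2 ^ n)"
        by (simp only: div_mult_mod_eq)
      also have "\<dots> = real (3 * a div 2 ^ n) * 2 ^ n + real (3 * a mod 2 ^ n)"
        by simp
      finally show ?thesis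
        by (simp add: d field_simps)
    qed
    ultimately show ?thesis by blast
  qed
qed

context standard_brownian_motion
begin

lemma block_path_indep_reindex:
  fixes k :: "nat \<Rightarrow> nat"
  assumes "c > 0" "inj_on k {..<n}"
  shows "indep_vars (\<lambda>_. path_space) (\<lambda>j. block_path c (k j)) {..<n}"
proof (cases "n = 0")
  case True
  then show ?thesis by (simp add: indep_vars_def indep_sets_def)
next
  case False
  define N where "N = Suc (Max (k ` {..<n}))"
  have N: "k j < N" if "j < n" for j
    unfolding N_def using that by (auto simp: less_Suc_eq_le intro!: Max_ge)
  have "indep_vars (\<lambda>j. PiM {k j} (\<lambda>_. path_space)) (\<lambda>j \<omega>. restrict (\<lambda>i. block_path c i \<omega>) {k j}) {..<n}"
    using N assms(2) by (intro indep_vars_restrict[OF block_path_indep[OF assms(1), of N]])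
      (auto simp: N_def disjoint_family_on_def inj_on_def)
  then have "indep_vars (\<lambda>_. path_space) (\<lambda>j \<omega>. (\<lambda>x. x (k j)) (restrict (\<lambda>i. block_path c i \<omega>) {k j})) {..<n}"
    by (rule indep_vars_compose2) auto
  then show ?thesis
    by simp
qed

text \<open>Distinct blocks are independent with one common law, so the joint law does not depend on
  which blocks are chosen.\<close>

lemma block_tuple_law:
  fixes k :: "nat \<Rightarrow> nat"
  assumes "c > 0" "inj_on k {..<n}" "n > 0"
  shows "distr M (PiM {..<n} (\<lambda>_. path_space)) (\<lambda>\<omega>. \<lambda>j\<in>{..<n}. block_path c (k j) \<omega>)
    = PiM {..<n} (\<lambda>_. distr M path_space (block_path 1 0))"
proof -
  have "{..<n} \<noteq> {}" using assms by auto
  then have "distr M (PiM {..<n} (\<lambda>_. path_space)) (\<lambda>\<omega>. \<lambda>j\<in>{..<n}. block_path c (k j) \<omega>)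
    = PiM {..<n} (\<lambda>j. distr M path_space (block_path c (k j)))"
    using block_path_indep_reindex[OF assms(1,2)] block_path_measurable assms
    by (subst (asm) indep_vars_iff_distr_eq_PiM') auto
  also have "\<dots> = PiM {..<n} (\<lambda>_. distr M path_space (block_path 1 0))"
    using assms by (intro PiM_cong block_path_law) auto
  finally show ?thesis .
qed

lemma block_end_eq_grid_incr: "block c k 1 \<omega> = grid_incr c 0 k \<omega>"
  using block_dyadic[of 1 0 c k \<omega>] by simp

lemma block_end_distributed:
  assumes "c > 0"
  shows "distributed M lborel (block c k 1) (\<lambda>x. ennreal (isotropic_normal_density 1 x))"
proof -
  have "block c k 1 = grid_incr c 0 k"
    by (simp add: fun_eq_iff block_end_eq_grid_incr)
  then show ?thesis
    using grid_incr_distr[OF assms, of 0 k] grid_incr_measurable[OF assms, of 0 k]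
    by (simp add: distributed_def cong: distr_cong)
qed

lemma block_end_indep:
  assumes "c > 0" "finite I"
  shows "indep_vars (\<lambda>_. borel) (\<lambda>k. block c k 1) I"
proof -
  have "I \<subseteq> {..<Suc (Max I)}"
    using assms by (auto simp: less_Suc_eq_le)
  then show ?thesis
    using indep_vars_subset[OF grid_incr_indep[OF assms(1), of 0]]
    by (simp add: fun_eq_iff block_end_eq_grid_incr[abs_def])
qed

text \<open>The indices 2 to 5 match the four components of \<open>comb\<close>: total increments of
  four blocks, used as a random displacement in \<open>space12\<close>.\<close>

definition gauss4 :: "real \<Rightarrow> (nat \<Rightarrow> nat) \<Rightarrow> 'a \<Rightarrow> (real^'d) \<times> (real^'d) \<times> (real^'d) \<times> (real^'d)" where
  "gauss4 c k \<omega> = (block c (k 2) 1 \<omega>, block c (k 3) 1 \<omega>, block c (k 4) 1 \<omega>, block c (k 5) 1 \<omega>)"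

text \<open>The four increments are independent, and the product density is assembled from the
  innermost pair outwards.\<close>

lemma gauss4_distributed:
  assumes "c > 0" "inj_on k {2..5}"
  shows "\<exists>f. distributed M lborel (gauss4 c k) f \<and> (\<forall>g. f g > 0)"
proof -
  let ?f = "\<lambda>x::real^'d. ennreal (isotropic_normal_density 1 x)"
  have pos: "?f x > 0" for x
    by (simp add: isotropic_normal_density_pos)
  have kne: "k 2 \<noteq> k 3" "k 2 \<noteq> k 4" "k 2 \<noteq> k 5" "k 3 \<noteq> k 4" "k 3 \<noteq> k 5" "k 4 \<noteq> k 5"
    using inj_onD[OF assms(2)] by force+
  have ind: "indep_vars (\<lambda>_. borel) (\<lambda>k. block c k 1) {k 2, k 3, k 4, k 5}"
    using assms by (intro block_end_indep) auto
  note D = block_end_distributed[OF assms(1)]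
  note J = distributed_joint_indep'[OF lborel.sigma_finite_measure_axioms lborel.sigma_finite_measure_axioms D]
  have "distributed M lborel (\<lambda>\<omega>. (block c (k 4) 1 \<omega>, block c (k 5) 1 \<omega>)) (\<lambda>(z, w). ?f z * ?f w)"
    using J[OF D, of "k 4" "k 5"] kne
      indep_vars_pair_law[OF ind, of "{k 4}" "{k 5}" "\<lambda>x. x (k 4)" lborel "\<lambda>x. x (k 5)" lborel]
    by (simp add: lborel_prod)
  note J[OF this, of "k 3"]
  then have "distributed M lborel (\<lambda>\<omega>. (block c (k 3) 1 \<omega>, block c (k 4) 1 \<omega>, block c (k 5) 1 \<omega>))
      (\<lambda>(y, q). ?f y * (case q of (z, w) \<Rightarrow> ?f z * ?f w))"
    using kne indep_vars_pair_law[OF ind, of "{k 3}" "{k 4, k 5}" "\<lambda>x. x (k 3)" lborel "\<lambda>x. (x (k 4), x (k 5))" lborel]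
    by (simp add: lborel_prod)
  note J[OF this, of "k 2"]
  then have D2345: "distributed M lborel (gauss4 c k)
      (\<lambda>(x, r). ?f x * (case r of (y, q) \<Rightarrow> ?f y * (case q of (z, w) \<Rightarrow> ?f z * ?f w)))"
    using kne indep_vars_pair_law[OF ind, of "{k 2}" "{k 3, k 4, k 5}" "\<lambda>x. x (k 2)" lborel
        "\<lambda>x. (x (k 3), x (k 4), x (k 5))" lborel]
    by (simp add: lborel_prod gauss4_def[abs_def])
  show ?thesis
  proof (intro exI conjI)
    show "distributed M lborel (gauss4 c k)
        (\<lambda>(x, r). ?f x * (case r of (y, q) \<Rightarrow> ?f y * (case q of (z, w) \<Rightarrow> ?f z * ?f w)))"
      by (rule D2345)
  qed (use pos in \<open>auto simp: ennreal_zero_less_mult_iff\<close>)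
qed

text \<open>The displacement is a function of the blocks \<open>k 2\<close> to \<open>k 5\<close>,
  evaluated at time 1, and these blocks are disjoint from those in \<open>R\<close>.\<close>

lemma gauss4_indep:
  assumes "c > 0" "finite R" "k ` {2..5} \<inter> R = {}"
  shows "distr M (PiM R (\<lambda>_. path_space) \<Otimes>\<^sub>M borel) (\<lambda>\<omega>. (\<lambda>j\<in>R. block_path c j \<omega>, gauss4 c k \<omega>))
    = distr M (PiM R (\<lambda>_. path_space)) (\<lambda>\<omega>. \<lambda>j\<in>R. block_path c j \<omega>) \<Otimes>\<^sub>M distr M borel (gauss4 c k)"
proof -
  define N where "N = Suc (Max (R \<union> k ` {2..5}))"
  have N: "R \<subseteq> {..<N}" "k ` {2..5} \<subseteq> {..<N}"
    using assms(2) by (auto simp: N_def less_Suc_eq_le intro!: Max_ge)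
  have "N > 0" by (simp add: N_def)
  have [measurable]: "(\<lambda>p. p i 1) \<in> PiM (k ` {2..5}) (\<lambda>_. path_space) \<rightarrow>\<^sub>M borel" if "i \<in> k ` {2..5}" for i
    by (rule measurable_compose[of "\<lambda>p. p i" _ path_space])
      (auto intro: measurable_component_singleton[of i, OF that] measurable_component_singleton[OF dyadics_1])
  let ?g = "\<lambda>p. (p (k 2) 1, p (k 3) 1, p (k 4) 1, p (k 5) 1)"
  have "?g \<in> PiM (k ` {2..5}) (\<lambda>_. path_space) \<rightarrow>\<^sub>M borel"
    by (intro borel_measurable_Pair) measurable
  from indep_vars_pair_law[OF block_path_indep[OF assms(1) \<open>N > 0\<close>], of R "k ` {2..5}", OF _ _ _ measurable_ident this]
  show ?thesis
    using assms(3) N dyadics_1 by (simp add: Int_commute gauss4_def[abs_def] block_path_def)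
qed

end

section \<open>Scaling and overlaps\<close>

text \<open>Inclusion and exclusion for the two chosen sets, subadditivity for the others. The
  additive form avoids subtraction of possibly infinite measures.\<close>

lemma emeasure_UN_Int_le_sum:
  assumes "finite I" "a \<in> I" "b \<in> I" "a \<noteq> b" "\<And>i. i \<in> I \<Longrightarrow> S i \<in> sets N"
  shows "emeasure N (\<Union>i\<in>I. S i) + emeasure N (S a \<inter> S b) \<le> (\<Sum>i\<in>I. emeasure N (S i))"
proof -
  let ?J = "I - {a} - {b}"
  have "(\<Union>i\<in>I. S i) = (S a \<union> S b) \<union> (\<Union>i\<in>?J. S i)"
    using assms by auto
  then have "emeasure N (\<Union>i\<in>I. S i) \<le> emeasure N (S a \<union> S b) + emeasure N (\<Union>i\<in>?J. S i)"
    using assms by (simp, intro emeasure_subadditive) auto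
  also have "\<dots> \<le> emeasure N (S a \<union> S b) + (\<Sum>i\<in>?J. emeasure N (S i))"
    using assms by (intro add_left_mono emeasure_subadditive_finite) auto
  finally have le: "emeasure N (\<Union>i\<in>I. S i) \<le> emeasure N (S a \<union> S b) + (\<Sum>i\<in>?J. emeasure N (S i))" .
  have "emeasure N (\<Union>i\<in>I. S i) + emeasure N (S a \<inter> S b)
      \<le> (emeasure N (S a \<union> S b) + emeasure N (S a \<inter> S b)) + (\<Sum>i\<in>?J. emeasure N (S i))"
    using add_right_mono[OF le, of "emeasure N (S a \<inter> S b)"] by (simp only: ac_simps)
  also have "emeasure N (S a \<union> S b) + emeasure N (S a \<inter> S b) = emeasure N (S a) + emeasure N (S b)"
    using assms by (subst emeasure_Un_Int) auto
  also have "emeasure N (S a) + emeasure N (S b) + (\<Sum>i\<in>?J. emeasure N (S i)) = (\<Sum>i\<in>I. emeasure N (S i))"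
    using assms by (simp add: sum.remove[of I a] sum.remove[of "I - {a}" b] add.assoc)
  finally show ?thesis .
qed

locale brownian_motion_3 = standard_brownian_motion M W
  for M :: "'a measure" and W :: "real \<Rightarrow> 'a \<Rightarrow> real ^ 3"
begin

definition hits_volume :: "(nat \<Rightarrow> real) \<Rightarrow> (nat \<Rightarrow> real) \<Rightarrow> real \<Rightarrow> (nat \<Rightarrow> nat) \<Rightarrow> 'a \<Rightarrow> ennreal" where
  "hits_volume \<alpha> \<beta> c k \<omega> = emeasure lborel (hits \<alpha> \<beta> (\<lambda>j. block_path c (k j) \<omega>))"

lemma hits_volume_measurable [measurable]: "c > 0 \<Longrightarrow> hits_volume \<alpha> \<beta> c k \<in> borel_measurable M"
  unfolding hits_volume_def by (intro emeasure_hits_measurable block_path_measurable)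

text \<open>The volume is a fixed measurable function of the six blocks, whose joint law is always
  the same by \<open>block_tuple_law\<close>.\<close>

lemma hits_volume_law:
  assumes "c > 0" "inj_on k {..<6}" "c' > 0" "inj_on k' {..<6}"
  shows "distr M borel (hits_volume \<alpha> \<beta> c k) = distr M borel (hits_volume \<alpha> \<beta> c' k')"
proof -
  let ?V = "\<lambda>b. emeasure lborel (hits \<alpha> \<beta> b)"
  have [measurable]: "?V \<in> borel_measurable (PiM {..<6} (\<lambda>_. path_space))"
    by (intro emeasure_hits_measurable measurable_component_singleton) auto
  have "distr M borel (hits_volume \<alpha> \<beta> c k) = distr (PiM {..<6} (\<lambda>_. distr M path_space (block_path 1 0))) borel ?V"
    if "c > 0" "inj_on k {..<6}" for c and k :: "nat \<Rightarrow> nat"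
  proof -
    note [measurable] = block_path_measurable[OF that(1)]
    have "hits_volume \<alpha> \<beta> c k = ?V \<circ> (\<lambda>\<omega>. \<lambda>j\<in>{..<6}. block_path c (k j) \<omega>)"
      by (auto simp: fun_eq_iff hits_volume_def intro!: arg_cong[where f="emeasure lborel"] hits_cong)
    then have "distr M borel (hits_volume \<alpha> \<beta> c k)
        = distr (distr M (PiM {..<6} (\<lambda>_. path_space)) (\<lambda>\<omega>. \<lambda>j\<in>{..<6}. block_path c (k j) \<omega>)) borel ?V"
      by (subst distr_distr) auto
    then show ?thesis
      using that by (subst (asm) block_tuple_law) auto
  qed
  then show ?thesis
    using assms by metis
qed

lemma hits_volume_integral_eq:
  assumes "c > 0" "inj_on k {..<6}" "c' > 0" "inj_on k' {..<6}"
  shows "(\<integral>\<^sup>+\<omega>. hits_volume \<alpha> \<beta> c k \<omega> \<partial>M) = (\<integral>\<^sup>+\<omega>. hits_volume \<alpha> \<beta> c' k' \<omega> \<partial>M)"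
proof -
  have "(\<integral>\<^sup>+\<omega>. hits_volume \<alpha> \<beta> c k \<omega> \<partial>M) = (\<integral>\<^sup>+x. x \<partial>distr M borel (hits_volume \<alpha> \<beta> c k))"
    if "c > 0" for c k
    using that by (subst nn_integral_distr) auto
  then show ?thesis
    using hits_volume_law[OF assms] assms by metis
qed

text \<open>The volume is at most a constant times the twelfth power of the largest norm on the
  segments. Chaining bounds that power by a multiple of the sum of the six
  \<open>chain_sum\<close>s, which is integrable.\<close>

lemma hits_volume_integral_finite:
  assumes "c > 0" "inj_on k {..<6}"
  shows "(\<integral>\<^sup>+\<omega>. hits_volume \<alpha> \<beta> c k \<omega> \<partial>M) < \<infinity>"
proof -
  define A where "A = unit_ball_vol 12 * ((\<Sum>i\<in>{2..5}. 1 + \<bar>\<alpha> i\<bar> + \<bar>\<beta> i\<bar>) * 5) ^ 12"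
  define V where "V \<omega> = (\<Sum>j<6. chain_sum c (k j) \<omega>)" for \<omega>
  have "A > 0"
    unfolding A_def by (intro mult_pos_pos zero_less_power unit_ball_vol_pos sum_pos) auto
  have "hits_volume \<alpha> \<beta> c k \<omega> \<le> ennreal A * V \<omega>" for \<omega>
  proof (cases "V \<omega> < \<infinity>")
    case False
    then show ?thesis
      using \<open>A > 0\<close> by (simp add: less_top[symmetric] ennreal_mult_top)
  next
    case True
    let ?r = "root 12 (enn2real (V \<omega>))"
    have "norm (block_path c (k j) \<omega> d) \<le> 5 * ?r" if "j < 6" "d \<in> dyadics" for j d
    proof -
      have le: "chain_sum c (k j) \<omega> \<le> V \<omega>"
        unfolding V_def using that by (intro member_le_sum) auto
      with True have "norm (block c (k j) d \<omega>) \<le> 5 * root 12 (enn2real (chain_sum c (k j) \<omega>))"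
        using that by (intro norm_block_le_chain_sum) auto
      also have "\<dots> \<le> 5 * ?r"
        using le True by (intro mult_left_mono) (auto intro: enn2real_mono)
      finally show ?thesis
        using that by (simp add: block_path_def)
    qed
    then have "hits_volume \<alpha> \<beta> c k \<omega> \<le> ennreal (unit_ball_vol 12 * ((\<Sum>i\<in>{2..5}. 1 + \<bar>\<alpha> i\<bar> + \<bar>\<beta> i\<bar>) * (5 * ?r)) ^ 12)"
      unfolding hits_volume_def by (rule emeasure_hits_le)
    also have "unit_ball_vol 12 * ((\<Sum>i\<in>{2..5}. 1 + \<bar>\<alpha> i\<bar> + \<bar>\<beta> i\<bar>) * (5 * ?r)) ^ 12 = A * ?r ^ 12"
      unfolding A_def mult.assoc[symmetric] by (subst power_mult_distrib) simp
    also have "?r ^ 12 = enn2real (V \<omega>)"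
      by simp
    finally show ?thesis
      using True \<open>A > 0\<close> by (simp add: ennreal_mult')
  qed
  then have "(\<integral>\<^sup>+\<omega>. hits_volume \<alpha> \<beta> c k \<omega> \<partial>M) \<le> (\<integral>\<^sup>+\<omega>. ennreal A * V \<omega> \<partial>M)"
    by (intro nn_integral_mono)
  also have "\<dots> = ennreal A * (\<Sum>j<6. \<integral>\<^sup>+\<omega>. chain_sum c (k j) \<omega> \<partial>M)"
    using chain_sum_measurable[OF assms(1)]
    by (simp add: V_def nn_integral_cmult nn_integral_sum)
  also have "\<dots> < \<infinity>"
    using chain_sum_integral_finite[OF assms(1)] by (simp add: ennreal_mult_less_top)
  finally show ?thesis .
qed

text \<open>A block of duration 3 runs through three unit blocks; \<open>sqrt 3\<close> undoes the
  difference between their normalisations.\<close>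

lemma block_3_split:
  assumes "3 * d = real i + d'"
  shows "sqrt 3 *\<^sub>R block 3 j d \<omega> = (\<Sum>i'<i. block 1 (3 * j + i') 1 \<omega>) + block 1 (3 * j + i) d' \<omega>"
proof -
  have "(\<Sum>i'<i. block 1 (3 * j + i') 1 \<omega>) = (\<Sum>i'<i. W (real (3 * j + Suc i')) \<omega> - W (real (3 * j + i')) \<omega>)"
    by (simp add: block_def algebra_simps)
  also have "\<dots> = W (real (3 * j + i)) \<omega> - W (real (3 * j)) \<omega>"
    by (subst sum_lessThan_telescope[of "\<lambda>i. W (real (3 * j + i)) \<omega>"]) simp
  finally have "(\<Sum>i'<i. block 1 (3 * j + i') 1 \<omega>) + block 1 (3 * j + i) d' \<omega>
      = W (real (3 * j + i) + d') \<omega> - W (real (3 * j)) \<omega>"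
    by (simp add: block_def)
  also have "real (3 * j + i) + d' = (real j + d) * 3"
    using assms by simp
  finally show ?thesis
    by (simp add: block_def mult.commute)
qed

text \<open>
  \<open>\<iota> j\<close> selects which third of the \<open>j\<close>-th block of length 3 is used; the translation is the
  displacement accumulated over the preceding thirds.
\<close>

definition sub_hits :: "(nat \<Rightarrow> real) \<Rightarrow> (nat \<Rightarrow> real) \<Rightarrow> 'a \<Rightarrow> (nat \<Rightarrow> nat) \<Rightarrow> space12 set" where
  "sub_hits \<alpha> \<beta> \<omega> \<iota> = (\<lambda>x. comb \<alpha> \<beta> (\<lambda>j. \<Sum>i<\<iota> j. block 1 (3 * j + i) 1 \<omega>) + 1 *\<^sub>R x)
    ` hits \<alpha> \<beta> (\<lambda>j. block_path 1 (3 * j + \<iota> j) \<omega>)"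

lemma closed_sub_hits: "closed (sub_hits \<alpha> \<beta> \<omega> \<iota>)"
  unfolding sub_hits_def using closed_translation[OF closed_hits] by simp

lemma closed_Union_sub_hits: "closed (\<Union>\<iota>\<in>{..<6} \<rightarrow>\<^sub>E {..<3}. sub_hits \<alpha> \<beta> \<omega> \<iota>)"
  by (rule closed_UN) (simp_all add: finite_PiE closed_sub_hits)

text \<open>Each of the six times lies in one of the three thirds of its block, which gives the
  inclusion at dyadic times. A finite union of closed sets is closed, so it also contains the
  closure.\<close>

lemma scaled_hits_subset:
  "(\<lambda>x. 0 + sqrt 3 *\<^sub>R x) ` hits \<alpha> \<beta> (\<lambda>j. block_path 3 j \<omega>)
    \<subseteq> (\<Union>\<iota>\<in>{..<6} \<rightarrow>\<^sub>E {..<3}. sub_hits \<alpha> \<beta> \<omega> \<iota>)"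
proof -
  have "(\<lambda>x. 0 + sqrt 3 *\<^sub>R x) ` hits \<alpha> \<beta> (\<lambda>j. block_path 3 j \<omega>)
      = closure ((\<lambda>x. sqrt 3 *\<^sub>R x) ` (\<lambda>d. comb \<alpha> \<beta> (\<lambda>j. block_path 3 j \<omega> (d j))) ` grid6)"
    unfolding hits_def by (simp add: closure_scaleR)
  also have "\<dots> \<subseteq> (\<Union>\<iota>\<in>{..<6} \<rightarrow>\<^sub>E {..<3}. sub_hits \<alpha> \<beta> \<omega> \<iota>)"
  proof (rule closure_minimal)
    show "closed (\<Union>\<iota>\<in>{..<6} \<rightarrow>\<^sub>E {..<3}. sub_hits \<alpha> \<beta> \<omega> \<iota>)"
      by (rule closed_Union_sub_hits)
    show "(\<lambda>x. sqrt 3 *\<^sub>R x) ` (\<lambda>d. comb \<alpha> \<beta> (\<lambda>j. block_path 3 j \<omega> (d j))) ` grid6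
        \<subseteq> (\<Union>\<iota>\<in>{..<6} \<rightarrow>\<^sub>E {..<3}. sub_hits \<alpha> \<beta> \<omega> \<iota>)"
    proof (clarify, simp only: UN_iff)
      fix d assume d: "d \<in> grid6"
      then have "\<forall>j\<in>{..<6}. \<exists>i d'. i < 3 \<and> d' \<in> dyadics \<and> 3 * d j = real i + d'"
        using dyadics_times_3 by (meson PiE_mem)
      then obtain i d' where id: "\<And>j. j < 6 \<Longrightarrow> i j < 3" "\<And>j. j < 6 \<Longrightarrow> d' j \<in> dyadics"
        "\<And>j. j < 6 \<Longrightarrow> 3 * d j = real (i j) + d' j"
        unfolding lessThan_iff Ball_def by metis
      define \<iota> where "\<iota> = restrict i {..<6}"
      define e where "e = restrict d' {..<6}"
      have "sqrt 3 *\<^sub>R comb \<alpha> \<beta> (\<lambda>j. block_path 3 j \<omega> (d j)) = comb \<alpha> \<beta> (\<lambda>j. sqrt 3 *\<^sub>R block_path 3 j \<omega> (d j))"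
        by (simp add: comb_scaleR)
      also have "\<dots> = comb \<alpha> \<beta> (\<lambda>j. (\<Sum>i<\<iota> j. block 1 (3 * j + i) 1 \<omega>) + block_path 1 (3 * j + \<iota> j) \<omega> (e j))"
      proof (rule comb_cong)
        fix j :: nat assume j: "j < 6"
        then have "d j \<in> dyadics" using d by auto
        with j show "sqrt 3 *\<^sub>R block_path 3 j \<omega> (d j)
            = (\<Sum>i<\<iota> j. block 1 (3 * j + i) 1 \<omega>) + block_path 1 (3 * j + \<iota> j) \<omega> (e j)"
          using block_3_split[OF id(3)[OF j], of j \<omega>] id(2)[OF j] by (simp add: block_path_def \<iota>_def e_def)
      qed
      also have "\<dots> \<in> sub_hits \<alpha> \<beta> \<omega> \<iota>"
      proof -
        have "e \<in> grid6"
          using id(2) by (simp add: e_def)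
        then show ?thesis
          unfolding sub_hits_def comb_add hits_def scaleR_one
          by (intro imageI closure_subset[THEN subsetD])
      qed
      finally show "\<exists>\<iota>\<in>{..<6} \<rightarrow>\<^sub>E {..<3}. sqrt 3 *\<^sub>R comb \<alpha> \<beta> (\<lambda>j. block_path 3 j \<omega> (d j)) \<in> sub_hits \<alpha> \<beta> \<omega> \<iota>"
        using id(1) by (intro bexI[of _ \<iota>]) (simp_all add: \<iota>_def)
    qed
  qed
  finally show ?thesis .
qed

text \<open>The tripled image has expected volume \<open>sqrt 3 ^ 12 * m\<close>, that is
  \<open>729 * m\<close>, and is covered by \<open>3 ^ 6 = 729\<close> pieces of expected volume
  \<open>m\<close> each. No volume can be lost in the covering, and as \<open>m\<close> is finite,
  the overlap of two pieces has expected volume 0.\<close>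

lemma hits_overlap_null:
  "AE \<omega> in M. emeasure lborel {z \<in> hits \<alpha> \<beta> (\<lambda>j. block_path 1 (3 * j) \<omega>).
      z - comb \<alpha> \<beta> (\<lambda>j. block 1 (3 * j) 1 \<omega> + block 1 (3 * j + 1) 1 \<omega>)
        \<in> hits \<alpha> \<beta> (\<lambda>j. block_path 1 (3 * j + 2) \<omega>)} = 0"
proof -
  let ?I = "{..<6::nat} \<rightarrow>\<^sub>E {..<3::nat}"
  \<comment> \<open>The pieces made of the first thirds only and of the last thirds only; the middle
    thirds between them are left to displace one against the other.\<close>
  let ?a = "\<lambda>j\<in>{..<6::nat}. 0::nat" and ?b = "\<lambda>j\<in>{..<6::nat}. 2::nat"
  define T where "T \<omega> = emeasure lborel {z \<in> hits \<alpha> \<beta> (\<lambda>j. block_path 1 (3 * j) \<omega>).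
      z - comb \<alpha> \<beta> (\<lambda>j. block 1 (3 * j) 1 \<omega> + block 1 (3 * j + 1) 1 \<omega>)
        \<in> hits \<alpha> \<beta> (\<lambda>j. block_path 1 (3 * j + 2) \<omega>)}" for \<omega>
  define m where "m = (\<integral>\<^sup>+\<omega>. hits_volume \<alpha> \<beta> 3 (\<lambda>j. j) \<omega> \<partial>M)"
  note [measurable] = block_path_measurable block_measurable
  have T[measurable]: "T \<in> borel_measurable M"
    unfolding T_def
  proof (rule emeasure_lborel_Collect_measurable)
    have [measurable]: "(\<lambda>\<omega>. comb \<alpha> \<beta> (\<lambda>j. block 1 (3 * j) 1 \<omega> + block 1 (3 * j + 1) 1 \<omega>)) \<in> borel_measurable M"
      by (rule comb_measurable) measurable
    show "Measurable.pred (M \<Otimes>\<^sub>M borel) (\<lambda>x. snd x \<in> hits \<alpha> \<beta> (\<lambda>j. block_path 1 (3 * j) (fst x)) \<and>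
        snd x - comb \<alpha> \<beta> (\<lambda>j. block 1 (3 * j) 1 (fst x) + block 1 (3 * j + 1) 1 (fst x))
        \<in> hits \<alpha> \<beta> (\<lambda>j. block_path 1 (3 * j + 2) (fst x)))"
      by measurable
  qed
  have m: "(\<integral>\<^sup>+\<omega>. hits_volume \<alpha> \<beta> 1 (\<lambda>j. 3 * j + \<iota> j) \<omega> \<partial>M) = m" if "\<iota> \<in> ?I" for \<iota>
    unfolding m_def
  proof (rule hits_volume_integral_eq)
    show "inj_on (\<lambda>j. 3 * j + \<iota> j) {..<6}"
    proof (rule inj_onI)
      fix x y assume "x \<in> {..<6}" "y \<in> {..<6}" "3 * x + \<iota> x = 3 * y + \<iota> y"
      moreover from this have "\<iota> x < 3" "\<iota> y < 3" using that by auto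
      ultimately show "x = y" by linarith
    qed
  qed auto
  have le: "729 * hits_volume \<alpha> \<beta> 3 (\<lambda>j. j) \<omega> + T \<omega> \<le> (\<Sum>\<iota>\<in>?I. hits_volume \<alpha> \<beta> 1 (\<lambda>j. 3 * j + \<iota> j) \<omega>)" for \<omega>
  proof -
    have sqrt: "sqrt 3 ^ 12 = (729::real)"
    proof -
      have "sqrt 3 ^ (2 * 6) = ((sqrt 3)\<^sup>2 ^ 6 :: real)"
        by (subst power_mult) simp
      then show ?thesis by simp
    qed
    have "729 * hits_volume \<alpha> \<beta> 3 (\<lambda>j. j) \<omega>
        = emeasure lborel ((\<lambda>x. 0 + sqrt 3 *\<^sub>R x) ` hits \<alpha> \<beta> (\<lambda>j. block_path 3 j \<omega>))"
      unfolding hits_volume_def by (subst emeasure_lborel_affine_image) (simp_all add: sqrt)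
    also have "\<dots> \<le> emeasure lborel (\<Union>\<iota>\<in>?I. sub_hits \<alpha> \<beta> \<omega> \<iota>)"
      using closed_Union_sub_hits by (intro emeasure_mono scaled_hits_subset) simp
    finally have 1: "729 * hits_volume \<alpha> \<beta> 3 (\<lambda>j. j) \<omega> \<le> emeasure lborel (\<Union>\<iota>\<in>?I. sub_hits \<alpha> \<beta> \<omega> \<iota>)" .
    have sub: "sub_hits \<alpha> \<beta> \<omega> \<iota> = {z. z - comb \<alpha> \<beta> (\<lambda>j. \<Sum>i<\<iota> j. block 1 (3 * j + i) 1 \<omega>)
        \<in> hits \<alpha> \<beta> (\<lambda>j. block_path 1 (3 * j + \<iota> j) \<omega>)}" for \<iota>
      unfolding sub_hits_def by (force simp: image_iff)
    have "sub_hits \<alpha> \<beta> \<omega> ?a = hits \<alpha> \<beta> (\<lambda>j. block_path 1 (3 * j) \<omega>)"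
    proof -
      \<comment> \<open>Written as a multiple by 0, so that \<open>comb_scaleR\<close> shows the
        displacement to vanish.\<close>
      have "comb \<alpha> \<beta> (\<lambda>j. \<Sum>i<?a j. block 1 (3 * j + i) 1 \<omega>) = comb \<alpha> \<beta> (\<lambda>j. 0 *\<^sub>R 0)"
        by (rule comb_cong) auto
      moreover have "hits \<alpha> \<beta> (\<lambda>j. block_path 1 (3 * j + ?a j) \<omega>) = hits \<alpha> \<beta> (\<lambda>j. block_path 1 (3 * j) \<omega>)"
        by (rule hits_cong) auto
      ultimately show ?thesis
        unfolding sub comb_scaleR by simp
    qed
    moreover have "sub_hits \<alpha> \<beta> \<omega> ?b = {z. z - comb \<alpha> \<beta> (\<lambda>j. block 1 (3 * j) 1 \<omega> + block 1 (3 * j + 1) 1 \<omega>)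
        \<in> hits \<alpha> \<beta> (\<lambda>j. block_path 1 (3 * j + 2) \<omega>)}"
    proof -
      have "comb \<alpha> \<beta> (\<lambda>j. \<Sum>i<?b j. block 1 (3 * j + i) 1 \<omega>) = comb \<alpha> \<beta> (\<lambda>j. block 1 (3 * j) 1 \<omega> + block 1 (3 * j + 1) 1 \<omega>)"
        by (rule comb_cong) (auto simp: numeral_2_eq_2)
      moreover have "hits \<alpha> \<beta> (\<lambda>j. block_path 1 (3 * j + ?b j) \<omega>) = hits \<alpha> \<beta> (\<lambda>j. block_path 1 (3 * j + 2) \<omega>)"
        by (rule hits_cong) auto
      ultimately show ?thesis
        unfolding sub by simp
    qed
    ultimately have 2: "T \<omega> = emeasure lborel (sub_hits \<alpha> \<beta> \<omega> ?a \<inter> sub_hits \<alpha> \<beta> \<omega> ?b)"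
      unfolding T_def by (auto intro!: arg_cong[where f="emeasure lborel"])
    have "?a 0 \<noteq> ?b 0" by simp
    then have ne: "?a \<noteq> ?b" by metis
    have "729 * hits_volume \<alpha> \<beta> 3 (\<lambda>j. j) \<omega> + T \<omega>
        \<le> emeasure lborel (\<Union>\<iota>\<in>?I. sub_hits \<alpha> \<beta> \<omega> \<iota>) + emeasure lborel (sub_hits \<alpha> \<beta> \<omega> ?a \<inter> sub_hits \<alpha> \<beta> \<omega> ?b)"
      unfolding 2 by (intro add_right_mono 1)
    also have "\<dots> \<le> (\<Sum>\<iota>\<in>?I. emeasure lborel (sub_hits \<alpha> \<beta> \<omega> \<iota>))"
      using ne by (intro emeasure_UN_Int_le_sum) (simp_all add: finite_PiE closed_sub_hits)
    also have "\<dots> = (\<Sum>\<iota>\<in>?I. hits_volume \<alpha> \<beta> 1 (\<lambda>j. 3 * j + \<iota> j) \<omega>)"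
      unfolding sub_hits_def hits_volume_def by (subst emeasure_lborel_affine_image) auto
    finally show ?thesis .
  qed
  have "729 * m + (\<integral>\<^sup>+\<omega>. T \<omega> \<partial>M) = (\<integral>\<^sup>+\<omega>. 729 * hits_volume \<alpha> \<beta> 3 (\<lambda>j. j) \<omega> + T \<omega> \<partial>M)"
    by (simp add: m_def nn_integral_add nn_integral_cmult)
  also have "\<dots> \<le> (\<integral>\<^sup>+\<omega>. (\<Sum>\<iota>\<in>?I. hits_volume \<alpha> \<beta> 1 (\<lambda>j. 3 * j + \<iota> j) \<omega>) \<partial>M)"
    by (intro nn_integral_mono le)
  also have "\<dots> = (\<Sum>\<iota>\<in>?I. m)"
    by (subst nn_integral_sum) (auto simp: m)
  also have "\<dots> = 729 * m"
    by (simp add: card_PiE)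
  \<comment> \<open>The summand 0 prepares for cancelling \<open>729 * m\<close>, which is
    legitimate only because \<open>m\<close> is finite.\<close>
  finally have "729 * m + (\<integral>\<^sup>+\<omega>. T \<omega> \<partial>M) \<le> 729 * m + 0"
    by simp
  moreover have "m < \<infinity>"
    unfolding m_def by (rule hits_volume_integral_finite) auto
  ultimately have "(\<integral>\<^sup>+\<omega>. T \<omega> \<partial>M) \<le> 0"
    by (subst (asm) ennreal_add_left_cancel_le) (auto simp: ennreal_mult_eq_top_iff)
  then have "AE \<omega> in M. T \<omega> = 0"
    by (simp add: nn_integral_0_iff_AE)
  then show ?thesis
    unfolding T_def .
qed

end

section \<open>Vanishing of the volume and separated segments\<close>

text \<open>The points 2 to 5 enter with coefficient one, so displacing them translates the value by
  the same vector, whatever \<alpha> and \<beta> are.\<close>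

lemma comb_split:
  "comb \<alpha> \<beta> x = comb \<alpha> \<beta> (\<lambda>j. if j < 2 then x j else 0) + (x 2, x 3, x 4, x 5)"
  by (simp add: comb_def)

text \<open>Taking partial sums is an invertible linear map, so the bad \<open>g\<close> lie in an
  affine image of a null set.\<close>

lemma AE_partial_sums_avoid_null:
  fixes S :: "space12 set"
  assumes "closed S" "emeasure lborel S = 0"
  shows "AE g in lborel. - (a + (case g of (p, q, r, s) \<Rightarrow> (p, p + q, p + q + r, p + q + r + s))) \<notin> S"
proof -
  let ?L = "\<lambda>g::space12. case g of (p, q, r, s) \<Rightarrow> (p, p + q, p + q + r, p + q + r + s)"
  \<comment> \<open>Successive differences, the inverse of \<open>?L\<close>.\<close>
  let ?K = "\<lambda>y::space12. case y of (p, q, r, s) \<Rightarrow> (p, q - p, r - q, s - r)"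
  let ?B = "{g. - (a + ?L g) \<in> S}"
  have lin: "negligible (f ` T)" if "linear f" "negligible T" for f :: "space12 \<Rightarrow> space12" and T
    using that by (intro negligible_differentiable_image_negligible linear_imp_differentiable_on) auto
  have "S \<in> null_sets lborel"
    using assms by (auto simp: null_sets_def)
  then have "negligible S"
    by (simp add: negligible_iff_null_sets null_sets_completionI)
  then have "negligible ((\<lambda>y. - y) ` S)"
    by (intro lin) (auto simp: linear_iff)
  then have "negligible ((+) (- a) ` (\<lambda>y. - y) ` S)"
    by (rule negligible_translation)
  moreover have "linear ?K"
    by (auto simp: linear_iff algebra_simps)
  ultimately have "negligible (?K ` (+) (- a) ` (\<lambda>y. - y) ` S)"
    by (rule lin[rotated])
  moreover have "?B \<subseteq> ?K ` (+) (- a) ` (\<lambda>y. - y) ` S"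
  proof
    fix g assume "g \<in> ?B"
    moreover have "g = ?K (- a + - (- (a + ?L g)))"
      by (simp split: prod.splits)
    ultimately show "g \<in> ?K ` (+) (- a) ` (\<lambda>y. - y) ` S"
      by blast
  qed
  ultimately have "negligible ?B"
    by (rule negligible_subset)
  \<comment> \<open>\<open>negligible\<close> refers to the completed measure; a closed set is Borel
    and hence null for \<open>lborel\<close> itself.\<close>
  moreover have "closed ?B"
  proof -
    have "continuous_on UNIV (\<lambda>g. - (a + ?L g))"
      unfolding case_prod_unfold by (intro continuous_intros)
    then have "closed ((\<lambda>g. - (a + ?L g)) -` S)"
      using assms(1) by (rule closed_vimage[rotated])
    then show ?thesis
      by (simp only: vimage_def)
  qed
  ultimately have "?B \<in> null_sets lborel"
    by (simp add: negligible_iff_null_sets null_sets_completion_iff)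
  then show ?thesis
    by (rule AE_I') auto
qed

text \<open>Here path continuity enters: rounding the six times down to dyadics gives values in
  \<open>hits\<close> that converge to the value at the true times.\<close>

lemma comb_mem_hits:
  assumes cont: "\<And>j. j < 6 \<Longrightarrow> continuous_on {0..1} (f j)"
    and r: "\<And>j. j < 6 \<Longrightarrow> r j \<in> {0..1}"
    and b: "\<And>j d. j < 6 \<Longrightarrow> d \<in> dyadics \<Longrightarrow> b j d = f j d"
  shows "comb \<alpha> \<beta> (\<lambda>j. f j (r j)) \<in> hits \<alpha> \<beta> b"
proof -
  define e where "e n = (\<lambda>j\<in>{..<6::nat}. real (nat \<lfloor>r j * 2 ^ n\<rfloor>) / 2 ^ n)" for n :: nat
  have e_dyadic: "e n j \<in> dyadics" if "j < 6" for n j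
  proof -
    have "\<lfloor>r j * 2 ^ n\<rfloor> \<le> \<lfloor>(2::real) ^ n\<rfloor>"
      using r[OF that] by (intro floor_mono) (simp add: mult_le_cancel_right1)
    then have "nat \<lfloor>r j * 2 ^ n\<rfloor> \<le> 2 ^ n"
      by (simp add: nat_le_iff)
    then show ?thesis
      using that by (auto simp: e_def intro: dyadicsI)
  qed
  have e_lim: "(\<lambda>n. e n j) \<longlonglongrightarrow> r j" if "j < 6" for j
  proof (rule tendsto_sandwich)
    have *: "(\<lambda>n. (1 / 2 :: real) ^ n) \<longlonglongrightarrow> 0"
      by (intro LIMSEQ_realpow_zero) auto
    show "(\<lambda>n. r j - (1 / 2) ^ n) \<longlonglongrightarrow> r j"
      using tendsto_diff[OF tendsto_const *, of "r j"] by simp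
    show "(\<lambda>n. r j) \<longlonglongrightarrow> r j" by simp
    have nn: "0 \<le> r j * 2 ^ n" for n
      using r[OF that] by simp
    show "\<forall>\<^sub>F n in sequentially. r j - (1 / 2) ^ n \<le> e n j"
    proof (intro always_eventually allI)
      fix n
      have "r j * 2 ^ n - 1 \<le> real (nat \<lfloor>r j * 2 ^ n\<rfloor>)"
        using nn[of n] by linarith
      then have "(r j * 2 ^ n - 1) / 2 ^ n \<le> real (nat \<lfloor>r j * 2 ^ n\<rfloor>) / 2 ^ n"
        by (intro divide_right_mono) auto
      then show "r j - (1 / 2) ^ n \<le> e n j"
        using that by (simp add: e_def diff_divide_distrib power_one_over)
    qed
    show "\<forall>\<^sub>F n in sequentially. e n j \<le> r j"
    proof (intro always_eventually allI)
      fix n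
      have "real (nat \<lfloor>r j * 2 ^ n\<rfloor>) \<le> r j * 2 ^ n"
        using nn[of n] by simp
      then show "e n j \<le> r j"
        using that by (simp add: e_def divide_le_eq)
    qed
  qed
  have lim: "(\<lambda>n. f j (e n j)) \<longlonglongrightarrow> f j (r j)" if "j < 6" for j
    using that r dyadics_bounds[OF e_dyadic[OF that]]
    by (intro continuous_on_tendsto_compose[OF cont e_lim]) auto
  have "(\<lambda>n. comb \<alpha> \<beta> (\<lambda>j. f j (e n j))) \<longlonglongrightarrow> comb \<alpha> \<beta> (\<lambda>j. f j (r j))"
    unfolding comb_def Let_def by (intro tendsto_intros lim) auto
  moreover have "comb \<alpha> \<beta> (\<lambda>j. f j (e n j)) \<in> hits \<alpha> \<beta> b" for n
  proof -
    have "e n \<in> grid6"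
      using e_dyadic[of _ n] by (auto simp: e_def)
    moreover have "comb \<alpha> \<beta> (\<lambda>j. f j (e n j)) = comb \<alpha> \<beta> (\<lambda>j. b j (e n j))"
      using e_dyadic b by (intro comb_cong) auto
    ultimately show ?thesis
      unfolding hits_def by (simp only:) (intro closure_subset[THEN subsetD] imageI)
  qed
  ultimately show ?thesis
    by (rule Lim_in_closed_set[OF closed_hits always_eventually[OF allI] trivial_limit_sequentially, rotated])
qed

context brownian_motion_3
begin

text \<open>
  The two images come from the first and the last thirds \<open>3 * j\<close> and \<open>3 * j + 2\<close>; the blocks 7, 10, 13, 16
  are the middle thirds for \<open>j = 2, \<dots>, 5\<close>, whose increments provide the displacement.
\<close>

lemma hits_volume_product_null:
  "AE \<omega> in M. hits_volume \<alpha> \<beta> 1 (\<lambda>j. 3 * j) \<omega> * hits_volume \<alpha> \<beta> 1 (\<lambda>j. 3 * j + 2) \<omega> = 0"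
proof -
  define R :: "nat set" where "R = {..<18} - {7, 10, 13, 16}"
  define k :: "nat \<Rightarrow> nat" where "k i = 3 * i + 1" for i
  define X where "X \<omega> = (\<lambda>j\<in>R. block_path 1 j \<omega>)" for \<omega>
  \<comment> \<open>The part of the displacement known from the blocks in \<open>R\<close>: all
    first thirds, and the middle thirds of the points 0 and 1. By \<open>comb_split\<close> the
    remaining middle thirds add exactly \<open>gauss4 1 k\<close>.\<close>
  define a where "a r = comb \<alpha> \<beta> (\<lambda>j. r (3 * j) 1 + (if j < 2 then r (3 * j + 1) 1 else 0))"
    for r :: "nat \<Rightarrow> real \<Rightarrow> real^3"
  define P where "P r g \<longleftrightarrow> emeasure lborel {z \<in> hits \<alpha> \<beta> (\<lambda>j. r (3 * j)). z - (a r + g) \<in> hits \<alpha> \<beta> (\<lambda>j. r (3 * j + 2))} = 0"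
    for r g
  have R: "3 * j \<in> R" "3 * j + 2 \<in> R" if "j < 6" for j
  proof -
    have "j \<in> {0, 1, 2, 3, 4, 5}" using that by auto
    then show "3 * j \<in> R" "3 * j + 2 \<in> R" by (auto simp: R_def)
  qed
  have R1: "3 * j + 1 \<in> R" if "j < 2" for j
  proof -
    have "j \<in> {0, 1}" using that by auto
    then show "3 * j + 1 \<in> R" by (auto simp: R_def)
  qed
  have [measurable]: "(\<lambda>r. r j) \<in> PiM R (\<lambda>_. path_space) \<rightarrow>\<^sub>M path_space" if "j \<in> R" for j
    using measurable_component_singleton[OF that, of "\<lambda>_. path_space"] .
  have [measurable]: "(\<lambda>q. q 1) \<in> path_space \<rightarrow>\<^sub>M borel"
    using measurable_component_singleton[OF dyadics_1] .
  have [measurable]: "a \<in> borel_measurable (PiM R (\<lambda>_. path_space))"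
    unfolding a_def
  proof (rule comb_measurable)
    fix j :: nat assume "j < 6"
    note [measurable] = R(1)[OF this]
    show "(\<lambda>r. r (3 * j) 1 + (if j < 2 then r (3 * j + 1) 1 else 0)) \<in> borel_measurable (PiM R (\<lambda>_. path_space))"
    proof (cases "j < 2")
      case True
      note [measurable] = R1[OF this]
      have "(\<lambda>r. r (3 * j) 1 + r (3 * j + 1) 1) \<in> borel_measurable (PiM R (\<lambda>_. path_space))"
        by measurable
      then show ?thesis using True by simp
    next
      case False
      then show ?thesis by simp
    qed
  qed
  have X[measurable]: "X \<in> M \<rightarrow>\<^sub>M PiM R (\<lambda>_. path_space)"
    unfolding X_def by (intro measurable_restrict block_path_measurable) simp
  have kR: "k ` {2..5} \<inter> R = {}"
    by (auto simp: k_def R_def)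
  have "inj_on k {2..5}"
    by (auto simp: inj_on_def k_def)
  from gauss4_distributed[OF zero_less_one this] obtain f
    where f: "distributed M lborel (gauss4 1 k) f" "\<And>g. f g > 0"
    by blast
  have P[measurable]: "Measurable.pred (PiM R (\<lambda>_. path_space) \<Otimes>\<^sub>M borel) (\<lambda>x. P (fst x) (snd x))"
  proof -
    let ?N = "PiM R (\<lambda>_. path_space) \<Otimes>\<^sub>M (borel :: space12 measure)"
    have "Measurable.pred (?N \<Otimes>\<^sub>M borel) (\<lambda>y. snd y \<in> hits \<alpha> \<beta> (\<lambda>j. fst (fst y) (3 * j)) \<and>
       snd y - (a (fst (fst y)) + snd (fst y)) \<in> hits \<alpha> \<beta> (\<lambda>j. fst (fst y) (3 * j + 2)))"
    proof (intro pred_intros_logic hits_pred_measurable)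
      fix j :: nat assume "j < 6"
      note [measurable] = R[OF this]
      show "(\<lambda>y. fst (fst y) (3 * j)) \<in> ?N \<Otimes>\<^sub>M borel \<rightarrow>\<^sub>M path_space"
        by measurable
      show "(\<lambda>y. fst (fst y) (3 * j + 2)) \<in> ?N \<Otimes>\<^sub>M borel \<rightarrow>\<^sub>M path_space"
        by measurable
    qed measurable
    from emeasure_lborel_Collect_measurable[where N="?N" and P="\<lambda>x z. z \<in> hits \<alpha> \<beta> (\<lambda>j. fst x (3 * j)) \<and>
       z - (a (fst x) + snd x) \<in> hits \<alpha> \<beta> (\<lambda>j. fst x (3 * j + 2))", OF this]
    show ?thesis
      unfolding P_def by measurable
  qed
  have hits_eq: "hits \<alpha> \<beta> (\<lambda>j. X \<omega> (3 * j)) = hits \<alpha> \<beta> (\<lambda>j. block_path 1 (3 * j) \<omega>)"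
    "hits \<alpha> \<beta> (\<lambda>j. X \<omega> (3 * j + 2)) = hits \<alpha> \<beta> (\<lambda>j. block_path 1 (3 * j + 2) \<omega>)" for \<omega>
    using R by (auto simp: X_def intro!: hits_cong)
  have "comb \<alpha> \<beta> (\<lambda>j. block 1 (3 * j) 1 \<omega> + block 1 (3 * j + 1) 1 \<omega>) = a (X \<omega>) + gauss4 1 k \<omega>" for \<omega>
  proof -
    have "a (X \<omega>) = comb \<alpha> \<beta> (\<lambda>j. block 1 (3 * j) 1 \<omega> + (if j < 2 then block 1 (3 * j + 1) 1 \<omega> else 0))"
      unfolding a_def
    proof (rule comb_cong)
      fix j :: nat assume "j < 6"
      then show "X \<omega> (3 * j) 1 + (if j < 2 then X \<omega> (3 * j + 1) 1 else 0)
          = block 1 (3 * j) 1 \<omega> + (if j < 2 then block 1 (3 * j + 1) 1 \<omega> else 0)"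
        using R(1)[of j] R1[of j] dyadics_1 by (simp add: X_def block_path_def)
    qed
    also have "\<dots> = comb \<alpha> \<beta> (\<lambda>j. block 1 (3 * j) 1 \<omega>) + comb \<alpha> \<beta> (\<lambda>j. if j < 2 then block 1 (3 * j + 1) 1 \<omega> else 0)"
      by (rule comb_add)
    finally show ?thesis
      unfolding comb_add comb_split[of \<alpha> \<beta> "\<lambda>j. block 1 (3 * j + 1) 1 \<omega>"]
      by (simp add: gauss4_def k_def add.assoc)
  qed
  then have "AE \<omega> in M. P (X \<omega>) (gauss4 1 k \<omega>)"
    using hits_overlap_null[of \<alpha> \<beta>] unfolding P_def hits_eq by simp
  then have "AE \<omega> in M. AE g in lborel. P (X \<omega>) g"
    using AE_indep_shift_iff[OF X gauss4_indep[OF zero_less_one _ kR, folded X_def] f P] by (simp add: R_def)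
  then show ?thesis
  proof eventually_elim
    case (elim \<omega>)
    then show ?case
      unfolding P_def hits_volume_def hits_eq by (intro AE_translates_null_imp) auto
  qed
qed

text \<open>The volumes for the blocks \<open>3 * j\<close> and \<open>3 * j + 2\<close> are
  independent, as these are disjoint groups among 18 blocks, and both have the law \<open>D\<close>.
  Their product vanishes almost surely, which forces \<open>D\<close> to be concentrated at
  0.\<close>

lemma hits_volume_null:
  assumes "c > 0" "inj_on k {..<6}"
  shows "AE \<omega> in M. hits_volume \<alpha> \<beta> c k \<omega> = 0"
proof -
  let ?A = "(\<lambda>j. 3 * j) ` {..<6::nat}" and ?B = "(\<lambda>j. 3 * j + 2) ` {..<6::nat}"
  let ?f = "\<lambda>x. emeasure lborel (hits \<alpha> \<beta> (\<lambda>j. x (3 * j)))"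
  let ?g = "\<lambda>x. emeasure lborel (hits \<alpha> \<beta> (\<lambda>j. x (3 * j + 2)))"
  let ?F = "hits_volume \<alpha> \<beta> 1 (\<lambda>j. 3 * j)" and ?G = "hits_volume \<alpha> \<beta> 1 (\<lambda>j. 3 * j + 2)"
  define D where "D = distr M borel (hits_volume \<alpha> \<beta> c k)"
  have DF: "distr M borel ?F = D" and DG: "distr M borel ?G = D"
    unfolding D_def using assms by (auto intro!: hits_volume_law inj_onI)
  interpret D: prob_space D
    unfolding D_def using assms by (intro prob_space_distr) measurable
  interpret DD: pair_sigma_finite D D ..
  have [simp]: "sets D = sets borel" by (simp add: D_def)
  have f: "?f \<in> borel_measurable (PiM ?A (\<lambda>_. path_space))"
    by (intro emeasure_hits_measurable) (auto intro!: measurable_component_singleton[where M="\<lambda>_. path_space"])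
  have g: "?g \<in> borel_measurable (PiM ?B (\<lambda>_. path_space))"
    by (intro emeasure_hits_measurable) (auto intro!: measurable_component_singleton[where M="\<lambda>_. path_space"])
  have eq: "?f (\<lambda>j\<in>?A. block_path 1 j \<omega>) = ?F \<omega>" "?g (\<lambda>j\<in>?B. block_path 1 j \<omega>) = ?G \<omega>" for \<omega>
    by (auto simp: hits_volume_def intro!: arg_cong[where f="emeasure lborel"] hits_cong)
  have disj: "?A \<inter> ?B = {}" by auto presburger
  have sub: "?A \<subseteq> {..<18}" "?B \<subseteq> {..<18}" by auto
  have "distr M (borel \<Otimes>\<^sub>M borel) (\<lambda>\<omega>. (?F \<omega>, ?G \<omega>)) = D \<Otimes>\<^sub>M D"
    using indep_vars_pair_law[OF block_path_indep[of 1 18] disj sub f g] unfolding eq DF DG by simp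
  moreover have "AE x in distr M (borel \<Otimes>\<^sub>M borel) (\<lambda>\<omega>. (?F \<omega>, ?G \<omega>)). fst x * snd x = 0"
    using hits_volume_product_null[of \<alpha> \<beta>] by (subst AE_distr_iff) auto
  ultimately have "AE x in D \<Otimes>\<^sub>M D. fst x * snd x = 0"
    by metis
  from DD.AE_pair[OF this] have AE: "AE x in D. AE y in D. x * y = 0"
    by simp
  have "AE x in D. x = 0"
  \<comment> \<open>A single nonzero \<open>x\<close> with \<open>x * y = 0\<close> for almost every
    \<open>y\<close> would already give the claim.\<close>
  proof (rule ccontr)
    assume neg: "\<not> (AE x in D. x = 0)"
    have "AE x in D. x = 0"
      using AE
    proof eventually_elim
      case (elim x)
      show ?case
      proof (rule ccontr)
        assume "x \<noteq> 0"
        with elim have "AE y in D. y = 0" by simp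
        with neg show False by simp
      qed
    qed
    with neg show False by simp
  qed
  then show ?thesis
    unfolding D_def using assms by (subst (asm) AE_distr_iff) auto
qed

lemma W_eq_sum_blocks:
  assumes "c > 0"
  shows "(1 / sqrt c) *\<^sub>R (W (real n * c) \<omega> - W 0 \<omega>) = (\<Sum>l<n. block c l 1 \<omega>)"
proof -
  have "(\<Sum>l<n. block c l 1 \<omega>) = (1 / sqrt c) *\<^sub>R (\<Sum>l<n. W (real (Suc l) * c) \<omega> - W (real l * c) \<omega>)"
    by (simp add: block_def scaleR_sum_right add.commute)
  also have "\<dots> = (1 / sqrt c) *\<^sub>R (W (real n * c) \<omega> - W (real 0 * c) \<omega>)"
    by (subst sum_lessThan_telescope[of "\<lambda>l. W (real l * c) \<omega>"]) simp
  finally show ?thesis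
    by simp
qed

text \<open>A zero of the defect inside the six blocks would put minus the defect of their starting
  points into the hit set. That set is null and determined by the six blocks, while the gaps spread
  the starting points with a density. A distance of 2 between indices leaves a whole block free in
  front of each later segment.\<close>

lemma separated_blocks_avoid:
  assumes "c > 0" and gap: "\<And>i. i < 5 \<Longrightarrow> k i + 2 \<le> k (Suc i)"
  shows "AE \<omega> in M. - comb \<alpha> \<beta> (\<lambda>j. (1 / sqrt c) *\<^sub>R W (real (k j) * c) \<omega>) \<notin> hits \<alpha> \<beta> (\<lambda>j. block_path c (k j) \<omega>)"
proof -
  \<comment> \<open>the gap blocks; since only the later four points are displaced by them, the displacement
    acts on \<open>comb\<close> through a triangular map that does not involve \<open>\<alpha>\<close> and \<open>\<beta>\<close>\<close>
  define h where "h i = k i - 1" for i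
  define H where "H = h ` {2..5}"
  define R where "R = {..k 5} - H"
  define X where "X \<omega> = (\<lambda>j\<in>R. block_path c j \<omega>)" for \<omega>
  \<comment> \<open>The share of the blocks outside \<open>H\<close> in the six starting points. A
    starting point also contains every earlier gap increment, so the gaps contribute the partial
    sums \<open>L\<close>.\<close>
  define a where "a r = comb \<alpha> \<beta> (\<lambda>j. \<Sum>l\<in>{..<k j} - H. r l 1)" for r :: "nat \<Rightarrow> real \<Rightarrow> real^3"
  define L where "L = (\<lambda>(p, q, r, s). (p, p + q, p + q + r, p + q + r + s) :: space12)"
  define P where "P r g \<longleftrightarrow> - (a r + L g) \<notin> hits \<alpha> \<beta> (\<lambda>j. r (k j))" for r g
  have ord: "k 0 + 2 \<le> k 1" "k 1 + 2 \<le> k 2" "k 2 + 2 \<le> k 3" "k 3 + 2 \<le> k 4" "k 4 + 2 \<le> k 5"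
    using gap[of 0] gap[of 1] gap[of 2] gap[of 3] gap[of 4] by (simp_all add: numeral_eq_Suc)
  have H: "H = {k 2 - 1, k 3 - 1, k 4 - 1, k 5 - 1}"
  proof -
    have "{2..5} = {2, 3, 4, 5::nat}" by auto
    then show ?thesis by (simp add: H_def h_def)
  qed
  have j6: "j \<in> {0, 1, 2, 3, 4, 5}" if "j < 6" for j :: nat
    using that by auto
  have inj: "inj_on k {..<6}"
  proof (rule inj_onI)
    fix x y :: nat assume "x \<in> {..<6}" "y \<in> {..<6}" "k x = k y"
    then show "x = y" using j6[of x] j6[of y] ord by auto
  qed
  have injh: "inj_on h {2..5}"
  proof (rule inj_onI)
    fix x y :: nat assume "x \<in> {2..5}" "y \<in> {2..5}" "h x = h y"
    moreover from this have "x \<in> {2, 3, 4, 5}" "y \<in> {2, 3, 4, 5}" by auto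
    ultimately show "x = y" using ord by (auto simp: h_def)
  qed
  have kR: "k j \<in> R" if "j < 6" for j
    using j6[OF that] ord by (auto simp: R_def H)
  have lR: "l \<in> R" if "j < 6" "l \<in> {..<k j} - H" for j l
    using j6[OF that(1)] that(2) ord by (auto simp: R_def)
  have hR: "h ` {2..5} \<inter> R = {}" and "finite R"
    by (auto simp: R_def H_def)
  from gauss4_distributed[OF assms(1) injh] obtain f
    where f: "distributed M lborel (gauss4 c h) f" "\<And>g. f g > 0"
    by blast
  have X[measurable]: "X \<in> M \<rightarrow>\<^sub>M PiM R (\<lambda>_. path_space)"
    unfolding X_def using assms by (intro measurable_restrict block_path_measurable)
  have comp[measurable]: "(\<lambda>r. r j) \<in> PiM R (\<lambda>_. path_space) \<rightarrow>\<^sub>M path_space" if "j \<in> R" for j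
    using measurable_component_singleton[OF that, of "\<lambda>_. path_space"] .
  have [measurable]: "(\<lambda>q. q 1) \<in> path_space \<rightarrow>\<^sub>M borel"
    using measurable_component_singleton[OF dyadics_1] .
  have [measurable]: "a \<in> borel_measurable (PiM R (\<lambda>_. path_space))"
    unfolding a_def
  proof (rule comb_measurable)
    fix j :: nat assume "j < 6"
    note [measurable] = lR[OF this]
    show "(\<lambda>r. \<Sum>l\<in>{..<k j} - H. r l 1) \<in> borel_measurable (PiM R (\<lambda>_. path_space))"
      by measurable
  qed
  have [measurable]: "L \<in> borel_measurable borel"
    unfolding L_def case_prod_unfold
    by (intro borel_measurable_continuous_onI continuous_intros)
  have P[measurable]: "Measurable.pred (PiM R (\<lambda>_. path_space) \<Otimes>\<^sub>M borel) (\<lambda>x. P (fst x) (snd x))"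
    unfolding P_def
  proof (intro pred_intros_logic hits_pred_measurable)
    fix j :: nat assume "j < 6"
    note [measurable] = kR[OF this]
    show "(\<lambda>x. fst x (k j)) \<in> PiM R (\<lambda>_. path_space) \<Otimes>\<^sub>M borel \<rightarrow>\<^sub>M path_space"
      by measurable
  qed measurable
  have hits_eq: "hits \<alpha> \<beta> (\<lambda>j. X \<omega> (k j)) = hits \<alpha> \<beta> (\<lambda>j. block_path c (k j) \<omega>)" for \<omega>
    using kR by (auto simp: X_def intro!: hits_cong)
  have "AE \<omega> in M. AE g in lborel. P (X \<omega>) g"
    using hits_volume_null[OF assms(1) inj, of \<alpha> \<beta>]
  proof eventually_elim
    case (elim \<omega>)
    then show ?case
      unfolding P_def L_def hits_eq hits_volume_def
      by (intro AE_partial_sums_avoid_null) auto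
  qed
  then have "AE \<omega> in M. P (X \<omega>) (gauss4 c h \<omega>)"
    using AE_indep_shift_iff[OF X gauss4_indep[OF assms(1) \<open>finite R\<close> hR, folded X_def] f P] by simp
  then show ?thesis
    \<comment> \<open>Since the path starts at 0, its position at time \<open>k j * c\<close> is, up
      to normalisation, the sum of the preceding block increments.\<close>
    using start_at_origin
  proof eventually_elim
    case (elim \<omega>)
    have "comb \<alpha> \<beta> (\<lambda>j. (1 / sqrt c) *\<^sub>R W (real (k j) * c) \<omega>) = comb \<alpha> \<beta> (\<lambda>j. \<Sum>l<k j. block c l 1 \<omega>)"
      using elim(2) W_eq_sum_blocks[OF assms(1), of "k _" \<omega>] by simp
    also have "\<dots> = comb \<alpha> \<beta> (\<lambda>j. (\<Sum>l\<in>{..<k j} - H. block c l 1 \<omega>) + (\<Sum>l\<in>{..<k j} \<inter> H. block c l 1 \<omega>))"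
      by (intro comb_cong) (simp add: sum.Int_Diff[of "{..<k _}" _ H] add.commute)
    also have "\<dots> = comb \<alpha> \<beta> (\<lambda>j. \<Sum>l\<in>{..<k j} - H. block c l 1 \<omega>) + comb \<alpha> \<beta> (\<lambda>j. \<Sum>l\<in>{..<k j} \<inter> H. block c l 1 \<omega>)"
      by (rule comb_add)
    also have "comb \<alpha> \<beta> (\<lambda>j. \<Sum>l\<in>{..<k j} - H. block c l 1 \<omega>) = a (X \<omega>)"
      unfolding a_def using lR dyadics_1 by (intro comb_cong sum.cong) (auto simp: X_def block_path_def)
    also have "comb \<alpha> \<beta> (\<lambda>j. \<Sum>l\<in>{..<k j} \<inter> H. block c l 1 \<omega>) = L (gauss4 c h \<omega>)"
    proof -
      have "{..<k 0} \<inter> H = {}" "{..<k 1} \<inter> H = {}" "{..<k 2} \<inter> H = {h 2}" "{..<k 3} \<inter> H = {h 2, h 3}"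
        "{..<k 4} \<inter> H = {h 2, h 3, h 4}" "{..<k 5} \<inter> H = {h 2, h 3, h 4, h 5}"
        using ord by (auto simp: H h_def)
      moreover have "h 2 \<noteq> h 3" "h 2 \<noteq> h 4" "h 2 \<noteq> h 5" "h 3 \<noteq> h 4" "h 3 \<noteq> h 5" "h 4 \<noteq> h 5"
        using ord by (auto simp: h_def)
      ultimately show ?thesis
        unfolding comb_def Let_def by (simp add: L_def gauss4_def add.assoc)
    qed
    finally show ?case
      using elim(1) by (simp add: P_def hits_eq)
  qed
qed

end

section \<open>From progressions to separated segments\<close>

text \<open>Here \<open>p i\<close> is the place in the progression of the \<open>i\<close>-th
  visited point. The coefficients are those of affine interpolation on the line through the first
  two: they sum to 1 and carry \<open>p 0\<close> and \<open>p 1\<close> to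
  \<open>p i\<close>.\<close>

lemma arith_prog_comb_eq_0:
  assumes "p 0 \<noteq> p 1" "\<And>i. i < 6 \<Longrightarrow> x i = a + p i *\<^sub>R v"
  shows "comb (\<lambda>i. (p 1 - p i) / (p 1 - p 0)) (\<lambda>i. (p i - p 0) / (p 1 - p 0)) x = 0"
proof -
  define D where "D = p 1 - p 0"
  have D: "D \<noteq> 0" using assms(1) by (simp add: D_def)
  have "x i - ((p 1 - p i) / D) *\<^sub>R x 0 - ((p i - p 0) / D) *\<^sub>R x 1 = 0" if "i < 6" for i
  proof -
    have "(p 1 - p i) + (p i - p 0) = D"
      by (simp add: D_def)
    then have 1: "(p 1 - p i) / D + (p i - p 0) / D = 1"
      using D by (metis add_divide_distrib divide_self)
    have "(p 1 - p i) * p 0 + (p i - p 0) * p 1 = p i * D"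
      by (simp add: D_def algebra_simps)
    then have 2: "(p 1 - p i) / D * p 0 + (p i - p 0) / D * p 1 = p i"
      using D by (simp add: field_simps)
    have "((p 1 - p i) / D) *\<^sub>R x 0 + ((p i - p 0) / D) *\<^sub>R x 1
        = ((p 1 - p i) / D + (p i - p 0) / D) *\<^sub>R a + ((p 1 - p i) / D * p 0 + (p i - p 0) / D * p 1) *\<^sub>R v"
      by (simp add: assms(2) algebra_simps)
    also have "\<dots> = x i"
      unfolding 1 2 using that by (simp add: assms(2))
    finally show ?thesis
      by (simp add: diff_diff_eq)
  qed
  from this[of 2] this[of 3] this[of 4] this[of 5] show ?thesis
    unfolding comb_def Let_def D_def[symmetric] zero_prod_def by simp
qed

text \<open>Used to list the points in the order of the visits; \<open>p i\<close> is an index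
  realising the \<open>i\<close>-th entry of the sorted list of times.\<close>

lemma inj_on_imp_increasing_enumeration:
  fixes t :: "nat \<Rightarrow> real" and n :: nat
  assumes "inj_on t {..<n}"
  shows "\<exists>p. (\<forall>i<n. p i < n) \<and> (\<forall>i j. i < j \<longrightarrow> j < n \<longrightarrow> t (p i) < t (p j))"
proof -
  let ?L = "sorted_list_of_set (t ` {..<n})"
  have len: "length ?L = n"
    using assms by (simp add: card_image)
  have "\<exists>q<n. t q = ?L ! i" if "i < n" for i
  proof -
    have "?L ! i \<in> set ?L"
      using that len by (intro nth_mem) simp
    then show ?thesis by auto
  qed
  then obtain p where p: "\<And>i. i < n \<Longrightarrow> p i < n \<and> t (p i) = ?L ! i"
    by metis
  have "sorted_wrt (<) ?L" by simp
  then have "t (p i) < t (p j)" if "i < j" "j < n" for i j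
    using that p[of i] p[of j] len by (simp add: sorted_wrt_iff_nth_less)
  then show ?thesis
    using p by blast
qed

theorem lemma2:
  fixes M :: "'a measure" and W :: "real \<Rightarrow> 'a \<Rightarrow> real ^ 3"
  assumes "standard_brownian_motion M W"
  shows "AE \<omega> in M. \<not> contains_arith_prog 6 (trace_of W \<omega>)"
proof -
  interpret standard_brownian_motion M W by (rule assms)
  interpret brownian_motion_3 M W by unfold_locales
  define c where "c n = 1 / real (Suc n)" for n
  \<comment> \<open>Orders of visit and block indices are encoded as lists, a countable type, so
    that one exceptional null set serves all of them and all mesh sizes \<open>c n\<close>.\<close>
  define A where "A ps i = (real (ps ! 1) - real (ps ! i)) / (real (ps ! 1) - real (ps ! 0))" for ps :: "nat list" and i
  define B where "B ps i = (real (ps ! i) - real (ps ! 0)) / (real (ps ! 1) - real (ps ! 0))" for ps :: "nat list" and i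
  have "AE \<omega> in M. \<forall>n ks ps. (\<forall>i<5. ks ! i + 2 \<le> ks ! Suc i) \<longrightarrow>
      - comb (A ps) (B ps) (\<lambda>j. (1 / sqrt (c n)) *\<^sub>R W (real (ks ! j) * c n) \<omega>)
        \<notin> hits (A ps) (B ps) (\<lambda>j. block_path (c n) (ks ! j) \<omega>)"
    unfolding AE_all_countable
  proof (intro allI)
    fix n and ks ps :: "nat list"
    show "AE \<omega> in M. (\<forall>i<5. ks ! i + 2 \<le> ks ! Suc i) \<longrightarrow>
      - comb (A ps) (B ps) (\<lambda>j. (1 / sqrt (c n)) *\<^sub>R W (real (ks ! j) * c n) \<omega>)
        \<notin> hits (A ps) (B ps) (\<lambda>j. block_path (c n) (ks ! j) \<omega>)"
    proof (cases "\<forall>i<5. ks ! i + 2 \<le> ks ! Suc i")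
      case True
      then have "AE \<omega> in M. - comb (A ps) (B ps) (\<lambda>j. (1 / sqrt (c n)) *\<^sub>R W (real (ks ! j) * c n) \<omega>)
        \<notin> hits (A ps) (B ps) (\<lambda>j. block_path (c n) (ks ! j) \<omega>)"
        by (intro separated_blocks_avoid) (auto simp: c_def)
      then show ?thesis by auto
    qed auto
  qed
  then show ?thesis
    using continuous_paths
  proof eventually_elim
    case (elim \<omega>)
    show ?case
    proof
      assume "contains_arith_prog 6 (trace_of W \<omega>)"
      then obtain a v where v: "v \<noteq> 0" and "\<forall>j<6. a + real j *\<^sub>R v \<in> trace_of W \<omega>"
        by (auto simp: contains_arith_prog_def)
      then have "\<forall>j<6. \<exists>t\<ge>0. W t \<omega> = a + real j *\<^sub>R v"
        by (fastforce simp: trace_of_def)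
      then obtain t where t: "\<And>j. j < 6 \<Longrightarrow> t j \<ge> 0" "\<And>j. j < 6 \<Longrightarrow> W (t j) \<omega> = a + real j *\<^sub>R v"
        by metis
      have "inj_on t {..<6}"
      proof (rule inj_onI)
        fix i j assume "i \<in> {..<6}" "j \<in> {..<6}" "t i = t j"
        then have "real i *\<^sub>R v = real j *\<^sub>R v"
          using t(2)[of i] t(2)[of j] by (metis add_left_cancel lessThan_iff)
        then show "i = j" using v by simp
      qed
      from inj_on_imp_increasing_enumeration[OF this] obtain p :: "nat \<Rightarrow> nat"
        where "(\<forall>i<6. p i < 6) \<and> (\<forall>i j. i < j \<longrightarrow> j < 6 \<longrightarrow> t (p i) < t (p j))"
        by (rule exE)
      then have p: "\<And>i. i < 6 \<Longrightarrow> p i < 6" "\<And>i j. i < j \<Longrightarrow> j < 6 \<Longrightarrow> t (p i) < t (p j)"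
        by simp_all
      define \<tau> where "\<tau> i = t (p i)" for i
      define \<delta> where "\<delta> = Min ((\<lambda>i. \<tau> (Suc i) - \<tau> i) ` {..<5})"
      have "\<delta> > 0"
        unfolding \<delta>_def using p(2) by (subst Min_gr_iff) (auto simp: \<tau>_def lessThan_empty_iff)
      \<comment> \<open>With a mesh of at most a third of the smallest gap between visits, the
        indices of the blocks visited differ by at least 2.\<close>
      then obtain n where "inverse (real (Suc n)) < \<delta> / 3"
        using reals_Archimedean[of "\<delta> / 3"] by auto
      then have n: "3 * c n \<le> \<delta>"
        by (simp add: c_def inverse_eq_divide)
      have gap: "\<tau> i + 3 * c n \<le> \<tau> (Suc i)" if "i < 5" for i
      proof -
        have "\<delta> \<le> \<tau> (Suc i) - \<tau> i"
          unfolding \<delta>_def using that by (intro Min_le) auto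
        with n show ?thesis by simp
      qed
      have c: "c n > 0" by (simp add: c_def)
      define k where "k i = nat \<lfloor>\<tau> i / c n\<rfloor>" for i
      have \<tau>0: "\<tau> i \<ge> 0" if "i < 6" for i
        using t(1) p(1) that by (simp add: \<tau>_def)
      have k: "real (k i) \<le> \<tau> i / c n" "\<tau> i / c n < real (k i) + 1" if "i < 6" for i
      proof -
        have "0 \<le> \<tau> i / c n" using \<tau>0[OF that] c by simp
        then show "real (k i) \<le> \<tau> i / c n" "\<tau> i / c n < real (k i) + 1"
          unfolding k_def by linarith+
      qed
      have kgap: "k i + 2 \<le> k (Suc i)" if "i < 5" for i
      proof -
        have "(\<tau> i + 3 * c n) / c n \<le> \<tau> (Suc i) / c n"
          using gap[OF that] c by (intro divide_right_mono) auto
        then have "\<tau> i / c n + 3 \<le> \<tau> (Suc i) / c n"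
          using c by (simp add: add_divide_distrib)
        then show ?thesis
          using k(1)[of i] k(2)[of "Suc i"] that by linarith
      qed
      define ks where "ks = map k [0..<6]"
      define ps where "ps = map p [0..<6]"
      have ks: "ks ! i = k i" and ps: "ps ! i = p i" if "i < 6" for i
        using that by (auto simp: ks_def ps_def)
      \<comment> \<open>The position of the visit within its block, relative to the block
        length.\<close>
      define r where "r j = \<tau> j / c n - real (k j)" for j
      have "comb (A ps) (B ps) (\<lambda>j. block (c n) (ks ! j) (r j) \<omega>) \<in> hits (A ps) (B ps) (\<lambda>j. block_path (c n) (ks ! j) \<omega>)"
      proof (rule comb_mem_hits)
        fix j :: nat assume "j < 6"
        then show "r j \<in> {0..1}"
          using k[of j] by (simp add: r_def)
        show "continuous_on {0..1} (\<lambda>d. block (c n) (ks ! j) d \<omega>)"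
          unfolding block_def using c
          by (intro continuous_intros continuous_on_compose2[OF elim(2)]) auto
      qed (simp add: block_path_def)
      \<comment> \<open>The block value is the normalised visited point minus the starting point of
        the block. The defect of the visited points is 0, so only that of the starting points
        remains, with a minus sign.\<close>
      also have "comb (A ps) (B ps) (\<lambda>j. block (c n) (ks ! j) (r j) \<omega>)
          = comb (A ps) (B ps) (\<lambda>j. (1 / sqrt (c n)) *\<^sub>R W (\<tau> j) \<omega> + (- 1) *\<^sub>R ((1 / sqrt (c n)) *\<^sub>R W (real (ks ! j) * c n) \<omega>))"
        using c by (intro comb_cong) (simp add: block_def r_def ks algebra_simps)
      also have "\<dots> = (1 / sqrt (c n)) *\<^sub>R comb (A ps) (B ps) (\<lambda>j. W (\<tau> j) \<omega>)
          - comb (A ps) (B ps) (\<lambda>j. (1 / sqrt (c n)) *\<^sub>R W (real (ks ! j) * c n) \<omega>)"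
        unfolding comb_add comb_scaleR by simp
      also have "comb (A ps) (B ps) (\<lambda>j. W (\<tau> j) \<omega>) = 0"
        unfolding A_def B_def
      proof (rule arith_prog_comb_eq_0)
        have "t (p 0) < t (p 1)" by (rule p(2)) auto
        then show "real (ps ! 0) \<noteq> real (ps ! 1)"
          using ps[of 0] ps[of 1] by auto
        show "W (\<tau> i) \<omega> = a + real (ps ! i) *\<^sub>R v" if "i < 6" for i
          using t(2)[OF p(1)[OF that]] ps[OF that] by (simp add: \<tau>_def)
      qed
      finally have "- comb (A ps) (B ps) (\<lambda>j. (1 / sqrt (c n)) *\<^sub>R W (real (ks ! j) * c n) \<omega>)
          \<in> hits (A ps) (B ps) (\<lambda>j. block_path (c n) (ks ! j) \<omega>)"
        by simp
      moreover have "\<forall>i<5. ks ! i + 2 \<le> ks ! Suc i"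
        using kgap ks by simp
      ultimately show False
        using elim(1) by blast
    qed
  qed
qed

end
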